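(* Let $n\geq2$ be an integer. (a) If $1\leq p\leq2$ and $\dim l^p\geq n$, then $\overline{C}_{NJ}^{(n)}(l^p)=\overline{C}_{mNJ}^{(n)}(l^p)=n^{\frac2p-1}$. (b) If $\dim l^\infty\geq2^{n-1}$, then $\overline{C}_{NJ}^{(n)}(l^\infty)=\overline{C}_{mNJ}^{(n)}(l^\infty)=n$. (c) If $\dim l^\infty\geq n$, then $\underline{C}_{NJ}^{(n)}(l^\infty)=\underline{C}_{mNJ}^{(n)}(l^\infty)=\frac1n$. (d) Let $(\Omega,\Sigma,\mu)$ be a measure space with non-atomic $\sigma$-finite measure $\mu$, $\mu(\Omega)>0$. Then $$\overline{C}_{mNJ}^{(n)}(L^1(\mu))=\overline{C}_{NJ}^{(n)}(L^1(\mu))=\overline{C}_{mNJ}^{(n)}(L^\infty(\mu))=\overline{C}_{NJ}^{(n)}(L^\infty(\mu))=n$$ and $$\underline{C}_{mNJ}^{(n)}(L^\infty(\mu))=\underline{C}_{NJ}^{(n)}(L^\infty(\mu))=\frac1n.$$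
   Context: All spaces are real. $l^p$ ($1\leq p\leq\infty$) denotes the sequence space with its usual $p$-norm, of finite or infinite dimension: either $l^p_k=(\mathbb{R}^k,\|\cdot\|_p)$ or the space of infinite $p$-summable (bounded, if $p=\infty$) sequences. For a real Banach space $X$ with unit sphere $S(X)$ and $x_1,\dots,x_n\in X$ with $\sum_{j=1}^n\|x_j\|_X^2>0$ put $$C^{(n)}(x_1,\dots,x_n)=\frac{\sum_{\theta_j=\pm1}\|x_1+\sum_{j=2}^n\theta_jx_j\|_X^2}{2^{n-1}\sum_{j=1}^n\|x_j\|_X^2},$$ the sum being over all $(\theta_2,\dots,\theta_n)\in\{-1,1\}^{n-1}$. The upper and lower $n$-th von Neumann-Jordan constants $\overline{C}_{NJ}^{(n)}(X)$ and $\underline{C}_{NJ}^{(n)}(X)$ are the supremum and the infimum, respectively, of $C^{(n)}(x_1,\dots,x_n)$ over all $x_1,\dots,x_n\in X$ with $\sum_j\|x_j\|_X^2>0$. The upper and lower modified constants $\overline{C}_{mNJ}^{(n)}(X)$ and $\underline{C}_{mNJ}^{(n)}(X)$ are the supremum and the infimum, respectively, of $C^{(n)}(x_1,\dots,x_n)$ over all $x_1,\dots,x_n\in S(X)$. *)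

theory Defs
  imports "HOL-Probability.Essential_Supremum" "HOL-Library.Extended_Nat"
begin

section \<open>Von Neumann-Jordan constants of a real normed space\<close>

text \<open>A real normed space is given by its carrier set, addition, scalar multiplication and norm.
  Type classes do not fit here: the spaces below depend on an exponent, a dimension or a measure.\<close>

record 'v rnspace =
  rcarrier :: "'v set"
  radd :: "'v \<Rightarrow> 'v \<Rightarrow> 'v"
  rscale :: "real \<Rightarrow> 'v \<Rightarrow> 'v"
  rnorm :: "'v \<Rightarrow> real"

definition unit_sphere :: "'v rnspace \<Rightarrow> 'v set" where
  "unit_sphere X = {v \<in> rcarrier X. rnorm X v = 1}"

text \<open>The vector \<open>x\<^sub>1 + \<theta>\<^sub>2 x\<^sub>2 + \<dots> + \<theta>\<^sub>n x\<^sub>n\<close>.\<close>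

definition signed_sum :: "nat \<Rightarrow> 'v rnspace \<Rightarrow> (nat \<Rightarrow> 'v) \<Rightarrow> (nat \<Rightarrow> real) \<Rightarrow> 'v" where
  "signed_sum n X x \<theta> = foldl (radd X) (x 1) (map (\<lambda>j. rscale X (\<theta> j) (x j)) [2..<Suc n])"

definition NJ_quot :: "nat \<Rightarrow> 'v rnspace \<Rightarrow> (nat \<Rightarrow> 'v) \<Rightarrow> real" where
  "NJ_quot n X x =
     (\<Sum>\<theta> \<in> {2..n} \<rightarrow>\<^sub>E {-1, 1}. (rnorm X (signed_sum n X x \<theta>))\<^sup>2) /
     (2 ^ (n - 1) * (\<Sum>j = 1..n. (rnorm X (x j))\<^sup>2))"

definition NJ_tuples :: "nat \<Rightarrow> 'v rnspace \<Rightarrow> (nat \<Rightarrow> 'v) set" where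
  "NJ_tuples n X = {x. (\<forall>j\<in>{1..n}. x j \<in> rcarrier X) \<and> (\<Sum>j = 1..n. (rnorm X (x j))\<^sup>2) > 0}"

definition mNJ_tuples :: "nat \<Rightarrow> 'v rnspace \<Rightarrow> (nat \<Rightarrow> 'v) set" where
  "mNJ_tuples n X = {x. \<forall>j\<in>{1..n}. x j \<in> unit_sphere X}"

definition upper_NJ :: "nat \<Rightarrow> 'v rnspace \<Rightarrow> real" where
  "upper_NJ n X = (SUP x \<in> NJ_tuples n X. NJ_quot n X x)"

definition lower_NJ :: "nat \<Rightarrow> 'v rnspace \<Rightarrow> real" where
  "lower_NJ n X = (INF x \<in> NJ_tuples n X. NJ_quot n X x)"

definition upper_mNJ :: "nat \<Rightarrow> 'v rnspace \<Rightarrow> real" where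
  "upper_mNJ n X = (SUP x \<in> mNJ_tuples n X. NJ_quot n X x)"

definition lower_mNJ :: "nat \<Rightarrow> 'v rnspace \<Rightarrow> real" where
  "lower_mNJ n X = (INF x \<in> mNJ_tuples n X. NJ_quot n X x)"


section \<open>The sequence spaces\<close>

text \<open>For \<open>d = \<infinity>\<close> these are the infinite sequences; for finite \<open>d\<close>, the \<open>d\<close>-dimensional space is
  represented by the sequences whose entries from index \<open>d\<close> on are zero.\<close>

definition lp_norm :: "ereal \<Rightarrow> (nat \<Rightarrow> real) \<Rightarrow> real" where
  "lp_norm p x =
     (if p = \<infinity> then (SUP i. \<bar>x i\<bar>)
      else (\<Sum>i. \<bar>x i\<bar> powr real_of_ereal p) powr (1 / real_of_ereal p))"

definition lp_set :: "ereal \<Rightarrow> enat \<Rightarrow> (nat \<Rightarrow> real) set" where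
  "lp_set p d =
     {x. (\<forall>i. d \<le> enat i \<longrightarrow> x i = 0) \<and>
         (if p = \<infinity> then bdd_above (range (\<lambda>i. \<bar>x i\<bar>))
          else summable (\<lambda>i. \<bar>x i\<bar> powr real_of_ereal p))}"

definition lp_space :: "ereal \<Rightarrow> enat \<Rightarrow> (nat \<Rightarrow> real) rnspace" where
  "lp_space p d =
     \<lparr>rcarrier = lp_set p d, radd = (\<lambda>x y i. x i + y i), rscale = (\<lambda>c x i. c * x i),
      rnorm = lp_norm p\<rparr>"


section \<open>Spaces of classes of almost everywhere equal functions\<close>

definition ae_rel :: "'a measure \<Rightarrow> (('a \<Rightarrow> real) \<times> ('a \<Rightarrow> real)) set" where
  "ae_rel M = {(f, g). f \<in> borel_measurable M \<and> g \<in> borel_measurable M \<and> (AE x in M. f x = g x)}"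

text \<open>The quotient by \<^term>\<open>ae_rel M\<close> of a set \<open>L\<close> of measurable functions, normed by a seminorm
  \<open>N\<close> that is invariant under \<^term>\<open>ae_rel M\<close>.\<close>

definition ae_quotient ::
    "'a measure \<Rightarrow> ('a \<Rightarrow> real) set \<Rightarrow> (('a \<Rightarrow> real) \<Rightarrow> real) \<Rightarrow> ('a \<Rightarrow> real) set rnspace" where
  "ae_quotient M L N =
     \<lparr>rcarrier = L // ae_rel M,
      radd = (\<lambda>F G. \<Union>f\<in>F. \<Union>g\<in>G. ae_rel M `` {\<lambda>x. f x + g x}),
      rscale = (\<lambda>c F. \<Union>f\<in>F. ae_rel M `` {\<lambda>x. c * f x}),
      rnorm = (\<lambda>F. the_elem (N ` F))\<rparr>"

definition L1_space :: "'a measure \<Rightarrow> ('a \<Rightarrow> real) set rnspace" where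
  "L1_space M = ae_quotient M {f. integrable M f} (\<lambda>f. \<integral>x. \<bar>f x\<bar> \<partial>M)"

definition Linf_space :: "'a measure \<Rightarrow> ('a \<Rightarrow> real) set rnspace" where
  "Linf_space M =
     ae_quotient M {f \<in> borel_measurable M. esssup M (\<lambda>x. ereal \<bar>f x\<bar>) < \<infinity>}
       (\<lambda>f. real_of_ereal (esssup M (\<lambda>x. ereal \<bar>f x\<bar>)))"

definition nonatomic :: "'a measure \<Rightarrow> bool" where
  "nonatomic M \<longleftrightarrow>
     (\<forall>A\<in>sets M. emeasure M A > 0 \<longrightarrow>
        (\<exists>B\<in>sets M. B \<subseteq> A \<and> 0 < emeasure M B \<and> emeasure M B < emeasure M A))"

text \<open>The operations are computed on representatives.\<close>

lemma equiv_ae_rel: "equiv (borel_measurable M) (ae_rel M)"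
proof (rule equivI)
  show "ae_rel M \<subseteq> borel_measurable M \<times> borel_measurable M"
    by (auto simp: ae_rel_def)
  show "refl_on (borel_measurable M) (ae_rel M)"
    by (auto simp: refl_on_def ae_rel_def)
  show "sym (ae_rel M)"
    by (auto simp: sym_def ae_rel_def eq_commute)
  show "trans (ae_rel M)"
  proof (rule transI)
    fix f g h assume "(f, g) \<in> ae_rel M" and "(g, h) \<in> ae_rel M"
    then show "(f, h) \<in> ae_rel M"
      unfolding ae_rel_def using AE_symmetric by fastforce
  qed
qed

lemma radd_ae_class:
  assumes [measurable]: "f \<in> borel_measurable M" "g \<in> borel_measurable M"
  shows "radd (ae_quotient M L N) (ae_rel M `` {f}) (ae_rel M `` {g}) = ae_rel M `` {\<lambda>x. f x + g x}"
proof -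
  have "congruent2 (ae_rel M) (ae_rel M) (\<lambda>f g. ae_rel M `` {\<lambda>x. f x + g x})"
  proof (rule congruent2I')
    fix f f' g g' assume "(f, f') \<in> ae_rel M" "(g, g') \<in> ae_rel M"
    then have "((\<lambda>x. f x + g x), (\<lambda>x. f' x + g' x)) \<in> ae_rel M"
      unfolding ae_rel_def by fastforce
    then show "ae_rel M `` {\<lambda>x. f x + g x} = ae_rel M `` {\<lambda>x. f' x + g' x}"
      using equiv_class_eq[OF equiv_ae_rel] by blast
  qed
  from UN_equiv_class2[OF equiv_ae_rel equiv_ae_rel this assms] show ?thesis
    by (simp add: ae_quotient_def)
qed

lemma rscale_ae_class:
  assumes "f \<in> borel_measurable M"
  shows "rscale (ae_quotient M L N) c (ae_rel M `` {f}) = ae_rel M `` {\<lambda>x. c * f x}"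
proof -
  have "congruent (ae_rel M) (\<lambda>f. ae_rel M `` {\<lambda>x. c * f x})"
  proof (rule congruentI)
    fix f f' assume "(f, f') \<in> ae_rel M"
    then have "((\<lambda>x. c * f x), (\<lambda>x. c * f' x)) \<in> ae_rel M"
      unfolding ae_rel_def by fastforce
    then show "ae_rel M `` {\<lambda>x. c * f x} = ae_rel M `` {\<lambda>x. c * f' x}"
      using equiv_class_eq[OF equiv_ae_rel] by blast
  qed
  from UN_equiv_class[OF equiv_ae_rel this assms] show ?thesis
    by (simp add: ae_quotient_def)
qed

lemma rnorm_ae_class:
  assumes "f \<in> borel_measurable M" and "\<And>g. (f, g) \<in> ae_rel M \<Longrightarrow> N g = N f"
  shows "rnorm (ae_quotient M L N) (ae_rel M `` {f}) = N f"
proof -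
  have "f \<in> ae_rel M `` {f}"
    using assms(1) by (simp add: ae_rel_def)
  then have "N ` (ae_rel M `` {f}) = {N f}"
    using assms(2) by blast
  then show ?thesis
    by (simp add: ae_quotient_def)
qed

lemma rnorm_L1_class:
  assumes "integrable M f"
  shows "rnorm (L1_space M) (ae_rel M `` {f}) = (\<integral>x. \<bar>f x\<bar> \<partial>M)"
  unfolding L1_space_def
proof (rule rnorm_ae_class)
  show "f \<in> borel_measurable M"
    using assms by simp
  fix g assume "(f, g) \<in> ae_rel M"
  then have [measurable]: "f \<in> borel_measurable M" "g \<in> borel_measurable M"
    and "AE x in M. f x = g x"
    by (simp_all add: ae_rel_def)
  from this(3) have "AE x in M. \<bar>g x\<bar> = \<bar>f x\<bar>"
    by (rule eventually_mono) simp
  then show "(\<integral>x. \<bar>g x\<bar> \<partial>M) = (\<integral>x. \<bar>f x\<bar> \<partial>M)"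
    by (intro integral_cong_AE) measurable
qed

lemma rnorm_Linf_class:
  assumes "f \<in> borel_measurable M"
  shows "rnorm (Linf_space M) (ae_rel M `` {f}) = real_of_ereal (esssup M (\<lambda>x. ereal \<bar>f x\<bar>))"
  unfolding Linf_space_def
proof (rule rnorm_ae_class)
  fix g assume "(f, g) \<in> ae_rel M"
  then have [measurable]: "f \<in> borel_measurable M" "g \<in> borel_measurable M"
    and "AE x in M. f x = g x"
    by (simp_all add: ae_rel_def)
  from this(3) have "AE x in M. ereal \<bar>g x\<bar> = ereal \<bar>f x\<bar>"
    by (rule eventually_mono) simp
  then have "esssup M (\<lambda>x. ereal \<bar>g x\<bar>) = esssup M (\<lambda>x. ereal \<bar>f x\<bar>)"
    by (intro esssup_AE_cong) measurable
  then show "real_of_ereal (esssup M (\<lambda>x. ereal \<bar>g x\<bar>)) = real_of_ereal (esssup M (\<lambda>x. ereal \<bar>f x\<bar>))"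
    by simp
qed (rule assms)

end

theory Submission
  imports Defs
begin

text \<open>Two bounds hold in every normed space. By the triangle and Cauchy-Schwarz inequalities the
  quotient is at most \<open>n\<close> (\<open>NJ_quot_le\<close>). It is at least \<open>1 / n\<close> (\<open>NJ_quot_ge\<close>), because each vector is
  half a sum or difference of two signed sums, so the mean of the squared norms of the signed sums
  is at least \<open>\<parallel>x\<^sub>j\<parallel>\<^sup>2\<close> for every \<open>j\<close>. For \<open>l\<^sup>p\<close> with \<open>1 \<le> p \<le> 2\<close> the upper bound improves to
  \<open>n\<^bsup>2/p - 1\<^esup>\<close> (\<open>sum_signs_powr_le\<close>): Minkowski's inequality reduces it to the orthogonality of the
  signs in each coordinate.

  These bounds are attained by unit vectors, so each constant coincides with its modified version:
  \<^item> the first \<open>n\<close> unit vectors of \<open>l\<^sup>p\<close>, or normalised indicators of \<open>n\<close> disjoint sets in \<open>L\<^sup>1\<close>; every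
    signed sum has norm \<open>n\<^bsup>1/p\<^esup>\<close>, where \<open>p = 1\<close> in the second case (\<open>lp_step_witness\<close>);
  \<^item> the first \<open>n\<close> unit vectors of \<open>l\<^sup>\<infinity>\<close>, or indicators of \<open>n\<close> disjoint sets in \<open>L\<^sup>\<infinity>\<close>; every signed sum
    has norm \<open>1\<close> (\<open>sup_step_lower_witness\<close>);
  \<^item> the \<open>n\<close> sign functions on \<open>2\<^bsup>n-1\<^esup>\<close> coordinates or disjoint sets, which are indexed by the
    choices of \<open>(\<theta>\<^sub>2, \<dots>, \<theta>\<^sub>n)\<close>; every signed sum has supremum norm \<open>n\<close> (\<open>sup_step_upper_witness\<close>).

  A non-atomic measure supplies arbitrarily many disjoint sets of finite positive measure
  (\<open>nonatomic_disjoint_sets\<close>). The proofs take place in spaces of functions; the locale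
  \<open>function_model\<close> carries them over to the sequence spaces and to the spaces of
  almost-everywhere classes.\<close>

section \<open>Signed combinations of functions\<close>

abbreviation signs :: "nat \<Rightarrow> (nat \<Rightarrow> real) set" where
  "signs n \<equiv> {2..n} \<rightarrow>\<^sub>E {-1, 1}"

lemma finite_signs: "finite (signs n)"
  by (intro finite_PiE) auto

lemma card_signs: "card (signs n) = 2 ^ (n - 1)"
proof -
  have "card (signs n) = 2 ^ card {2..n}"
    by (subst card_PiE) (simp_all add: card_insert_if numeral_2_eq_2)
  moreover have "card {2..n} = n - 1" by simp
  ultimately show ?thesis by (simp only:)
qed

lemma signs_cases: "\<theta> \<in> signs n \<Longrightarrow> j \<in> {2..n} \<Longrightarrow> \<theta> j = 1 \<or> \<theta> j = -1"
  by (auto simp: PiE_iff)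

definition signed_comb :: "nat \<Rightarrow> (nat \<Rightarrow> 'i \<Rightarrow> real) \<Rightarrow> (nat \<Rightarrow> real) \<Rightarrow> 'i \<Rightarrow> real" where
  "signed_comb n f \<theta> = (\<lambda>i. f 1 i + (\<Sum>j = 2..n. \<theta> j * f j i))"

lemma sum_flip_sign:
  assumes "j \<in> {2..n}"
  shows "(\<Sum>\<theta>\<in>signs n. g (\<theta>(j := - \<theta> j))) = (\<Sum>\<theta>\<in>signs n. g \<theta>)"
  by (rule sum.reindex_bij_witness[where i = "\<lambda>\<theta>. \<theta>(j := - \<theta> j)" and j = "\<lambda>\<theta>. \<theta>(j := - \<theta> j)"])
    (use assms in \<open>auto simp: PiE_iff extensional_def\<close>)

lemma sum_flip_all_signs:
  "(\<Sum>\<theta>\<in>signs n. g (restrict (\<lambda>j. - \<theta> j) {2..n})) = (\<Sum>\<theta>\<in>signs n. g \<theta>)"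
  by (rule sum.reindex_bij_witness[where i = "\<lambda>\<theta>. restrict (\<lambda>j. - \<theta> j) {2..n}"
        and j = "\<lambda>\<theta>. restrict (\<lambda>j. - \<theta> j) {2..n}"])
    (auto simp: PiE_iff extensional_def fun_eq_iff)

text \<open>The Rademacher signs are orthonormal: each new sign adds the square of its coefficient,
  and its cross terms cancel between \<open>1\<close> and \<open>-1\<close>. The term \<open>c\<close> stands for the vector without a sign.\<close>

lemma sum_signs_affine_power2:
  fixes y :: "'j \<Rightarrow> real"
  assumes "finite J"
  shows "(\<Sum>\<theta>\<in>J \<rightarrow>\<^sub>E {-1, 1}. (c + (\<Sum>j\<in>J. \<theta> j * y j))\<^sup>2) = 2 ^ card J * (c\<^sup>2 + (\<Sum>j\<in>J. (y j)\<^sup>2))"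
  using assms
proof (induction J arbitrary: c rule: finite_induct)
  case (insert k J)
  have upd: "c + (\<Sum>j\<in>insert k J. (\<theta>(k := s)) j * y j) = (c + s * y k) + (\<Sum>j\<in>J. \<theta> j * y j)"
    for \<theta> s
  proof -
    have "(\<Sum>j\<in>J. (\<theta>(k := s)) j * y j) = (\<Sum>j\<in>J. \<theta> j * y j)"
      using insert.hyps by (intro sum.cong) auto
    then show ?thesis
      using insert.hyps by simp
  qed
  have "(\<Sum>\<theta>\<in>insert k J \<rightarrow>\<^sub>E {-1, 1}. (c + (\<Sum>j\<in>insert k J. \<theta> j * y j))\<^sup>2)
      = (\<Sum>(s, \<theta>)\<in>{-1, 1} \<times> (J \<rightarrow>\<^sub>E {-1, 1}). ((c + s * y k) + (\<Sum>j\<in>J. \<theta> j * y j))\<^sup>2)"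
    unfolding PiE_insert_eq
    by (subst sum.reindex[OF inj_combinator[OF insert.hyps(2)]])
      (simp only: o_def case_prod_unfold upd)
  also have "\<dots> = (\<Sum>s\<in>{-1, 1}. 2 ^ card J * ((c + s * y k)\<^sup>2 + (\<Sum>j\<in>J. (y j)\<^sup>2)))"
    by (simp add: sum.cartesian_product[symmetric] insert.IH)
  also have "\<dots> = 2 ^ card (insert k J) * (c\<^sup>2 + (\<Sum>j\<in>insert k J. (y j)\<^sup>2))"
    using insert.hyps by (simp add: power2_eq_square algebra_simps)
  finally show ?case .
qed simp

lemma sum_signs_comb_power2:
  assumes "n \<ge> 1"
  shows "(\<Sum>\<theta>\<in>signs n. (signed_comb n f \<theta> i)\<^sup>2) = 2 ^ (n - 1) * (\<Sum>j = 1..n. (f j i)\<^sup>2)"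
proof -
  have "(\<Sum>j = 1..n. (f j i)\<^sup>2) = (f 1 i)\<^sup>2 + (\<Sum>j = 2..n. (f j i)\<^sup>2)"
    using assms by (subst sum.atLeast_Suc_atMost) (simp_all add: numeral_2_eq_2)
  moreover have "card {2..n} = n - 1" by simp
  ultimately show ?thesis
    unfolding signed_comb_def by (simp only: sum_signs_affine_power2 finite_atLeastAtMost)
qed

section \<open>Spaces modelled by functions\<close>

text \<open>All the spaces in question are images \<open>cls ` L\<close> of a set of real functions, with operations computed
  pointwise on representatives: \<open>cls\<close> is the identity for sequences and sends a function to its
  almost-everywhere class in \<open>L\<^sup>1\<close> and \<open>L\<^sup>\<infinity>\<close>. In such a model \<^const>\<open>NJ_quot\<close> becomes an expression
  in the functional \<open>N\<close> on functions.\<close>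

locale function_model =
  fixes X :: "'v rnspace" and L :: "('i \<Rightarrow> real) set" and N :: "('i \<Rightarrow> real) \<Rightarrow> real"
    and cls :: "('i \<Rightarrow> real) \<Rightarrow> 'v"
  assumes carrier: "rcarrier X = cls ` L"
    and radd_cls: "f \<in> L \<Longrightarrow> g \<in> L \<Longrightarrow> radd X (cls f) (cls g) = cls (\<lambda>i. f i + g i)"
    and rscale_cls: "f \<in> L \<Longrightarrow> rscale X c (cls f) = cls (\<lambda>i. c * f i)"
    and rnorm_cls: "f \<in> L \<Longrightarrow> rnorm X (cls f) = N f"
    and add_mem: "f \<in> L \<Longrightarrow> g \<in> L \<Longrightarrow> (\<lambda>i. f i + g i) \<in> L"
    and scale_mem: "f \<in> L \<Longrightarrow> (\<lambda>i. c * f i) \<in> L"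
begin

lemma signed_sum_cls:
  assumes "n \<ge> 1" "\<And>j. j \<in> {1..n} \<Longrightarrow> f j \<in> L" "\<And>j. j \<in> {1..n} \<Longrightarrow> x j = cls (f j)"
  shows "signed_comb n f \<theta> \<in> L \<and> signed_sum n X x \<theta> = cls (signed_comb n f \<theta>)"
  using assms
proof (induction n rule: nat_induct_at_least)
  case base
  then show ?case by (simp add: signed_comb_def signed_sum_def)
next
  case (Suc n)
  have last: "f (Suc n) \<in> L" "x (Suc n) = cls (f (Suc n))"
    using Suc.prems by auto
  have IH: "signed_comb n f \<theta> \<in> L" "signed_sum n X x \<theta> = cls (signed_comb n f \<theta>)"
    using Suc by auto
  have signed_comb: "signed_comb (Suc n) f \<theta> = (\<lambda>i. signed_comb n f \<theta> i + \<theta> (Suc n) * f (Suc n) i)"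
    using Suc.hyps by (auto simp: signed_comb_def fun_eq_iff)
  have "signed_sum (Suc n) X x \<theta> = radd X (signed_sum n X x \<theta>) (rscale X (\<theta> (Suc n)) (x (Suc n)))"
    using Suc.hyps by (simp add: signed_sum_def)
  also have "\<dots> = cls (signed_comb (Suc n) f \<theta>)"
    unfolding signed_comb IH last using IH(1) last(1) by (simp add: rscale_cls radd_cls scale_mem)
  finally show ?case
    unfolding signed_comb using add_mem[OF IH(1) scale_mem[OF last(1), of "\<theta> (Suc n)"]] by simp
qed

lemma comb_mem:
  assumes "n \<ge> 1" "\<And>j. j \<in> {1..n} \<Longrightarrow> f j \<in> L"
  shows "signed_comb n f \<theta> \<in> L"
  using signed_sum_cls[where x = "\<lambda>j. cls (f j)" and f = f and n = n] assms by simp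

lemma NJ_quot_cls:
  assumes "n \<ge> 1" "\<And>j. j \<in> {1..n} \<Longrightarrow> f j \<in> L" "\<And>j. j \<in> {1..n} \<Longrightarrow> x j = cls (f j)"
  shows "NJ_quot n X x =
    (\<Sum>\<theta>\<in>signs n. (N (signed_comb n f \<theta>))\<^sup>2) / (2 ^ (n - 1) * (\<Sum>j = 1..n. (N (f j))\<^sup>2))"
proof -
  have "rnorm X (signed_sum n X x \<theta>) = N (signed_comb n f \<theta>)" for \<theta>
    using signed_sum_cls[where x = x and f = f and n = n and \<theta> = \<theta>] assms by (simp add: rnorm_cls)
  moreover have "(\<Sum>j = 1..n. (rnorm X (x j))\<^sup>2) = (\<Sum>j = 1..n. (N (f j))\<^sup>2)"
    using assms rnorm_cls by (intro sum.cong) auto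
  ultimately show ?thesis by (simp add: NJ_quot_def)
qed

lemma NJ_tuples_cls:
  assumes "x \<in> NJ_tuples n X"
  obtains f where "\<And>j. j \<in> {1..n} \<Longrightarrow> f j \<in> L" "\<And>j. j \<in> {1..n} \<Longrightarrow> x j = cls (f j)"
    "(\<Sum>j = 1..n. (N (f j))\<^sup>2) > 0"
proof -
  have "\<forall>j\<in>{1..n}. \<exists>g. g \<in> L \<and> x j = cls g"
    using assms by (auto simp: NJ_tuples_def carrier)
  then obtain f where f: "\<forall>j\<in>{1..n}. f j \<in> L \<and> x j = cls (f j)"
    by metis
  have "(\<Sum>j = 1..n. (rnorm X (x j))\<^sup>2) = (\<Sum>j = 1..n. (N (f j))\<^sup>2)"
    using f rnorm_cls by (intro sum.cong) auto
  with assms f show ?thesis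
    by (intro that[of f]) (auto simp: NJ_tuples_def)
qed

text \<open>All the extremal tuples below have the same norm for every choice of signs, so that averaging over
  the signs is trivial.\<close>

lemma mNJ_witness:
  assumes "n \<ge> 1" and "\<And>j. j \<in> {1..n} \<Longrightarrow> f j \<in> L" and "\<And>j. j \<in> {1..n} \<Longrightarrow> N (f j) = 1"
    and "\<And>\<theta>. \<theta> \<in> signs n \<Longrightarrow> N (signed_comb n f \<theta>) = c"
  shows "(\<lambda>j. cls (f j)) \<in> mNJ_tuples n X" and "NJ_quot n X (\<lambda>j. cls (f j)) = c\<^sup>2 / n"
proof -
  show "(\<lambda>j. cls (f j)) \<in> mNJ_tuples n X"
    using assms(2,3) by (auto simp: mNJ_tuples_def unit_sphere_def carrier rnorm_cls)
  have "(\<Sum>j = 1..n. (N (f j))\<^sup>2) = (\<Sum>j = 1..n. 1)"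
    by (intro sum.cong) (simp_all add: assms(3))
  then have den: "(\<Sum>j = 1..n. (N (f j))\<^sup>2) = n"
    by simp
  have "(\<Sum>\<theta>\<in>signs n. (N (signed_comb n f \<theta>))\<^sup>2) = (\<Sum>\<theta>\<in>signs n. c\<^sup>2)"
    by (intro sum.cong) (simp_all add: assms(4))
  then have num: "(\<Sum>\<theta>\<in>signs n. (N (signed_comb n f \<theta>))\<^sup>2) = 2 ^ (n - 1) * c\<^sup>2"
    by (simp only: sum_constant card_signs of_nat_power of_nat_numeral)
  have "NJ_quot n X (\<lambda>j. cls (f j)) =
    (\<Sum>\<theta>\<in>signs n. (N (signed_comb n f \<theta>))\<^sup>2) / (2 ^ (n - 1) * (\<Sum>j = 1..n. (N (f j))\<^sup>2))"
    by (rule NJ_quot_cls) (use assms(1,2) in auto)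
  also have "\<dots> = c\<^sup>2 / n"
    unfolding num den by simp
  finally show "NJ_quot n X (\<lambda>j. cls (f j)) = c\<^sup>2 / n" .
qed

end

lemma mNJ_tuples_subset: "n \<ge> 1 \<Longrightarrow> mNJ_tuples n X \<subseteq> NJ_tuples n X"
proof
  fix x assume "n \<ge> 1" "x \<in> mNJ_tuples n X"
  then have x: "\<forall>j\<in>{1..n}. x j \<in> rcarrier X \<and> rnorm X (x j) = 1"
    by (simp add: mNJ_tuples_def unit_sphere_def)
  then have "(\<Sum>j = 1..n. (rnorm X (x j))\<^sup>2) = n"
    by simp
  with x \<open>n \<ge> 1\<close> show "x \<in> NJ_tuples n X"
    by (simp add: NJ_tuples_def)
qed

text \<open>The unit tuples are among the admissible ones, so an extremal tuple of unit vectors settles the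
  constant and its modified version at once.\<close>

lemma upper_constants_eqI:
  assumes "n \<ge> 1" "x \<in> mNJ_tuples n X" "NJ_quot n X x = c"
    and "\<And>y. y \<in> NJ_tuples n X \<Longrightarrow> NJ_quot n X y \<le> c"
  shows "upper_NJ n X = c \<and> upper_mNJ n X = c"
  unfolding upper_NJ_def upper_mNJ_def
  by (intro conjI cSup_eq_maximum)
    (use assms mNJ_tuples_subset[OF assms(1), of X] in blast)+

lemma lower_constants_eqI:
  assumes "n \<ge> 1" "x \<in> mNJ_tuples n X" "NJ_quot n X x = c"
    and "\<And>y. y \<in> NJ_tuples n X \<Longrightarrow> c \<le> NJ_quot n X y"
  shows "lower_NJ n X = c \<and> lower_mNJ n X = c"
  unfolding lower_NJ_def lower_mNJ_def
  by (intro conjI cInf_eq_minimum)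
    (use assms mNJ_tuples_subset[OF assms(1), of X] in blast)+

section \<open>The bounds valid in every normed space\<close>

locale seminorm_model = function_model +
  assumes N_add: "f \<in> L \<Longrightarrow> g \<in> L \<Longrightarrow> N (\<lambda>i. f i + g i) \<le> N f + N g"
    and N_scale: "f \<in> L \<Longrightarrow> N (\<lambda>i. c * f i) = \<bar>c\<bar> * N f"
begin

lemma N_nonneg: "f \<in> L \<Longrightarrow> 0 \<le> N f"
  using N_add[of f "\<lambda>i. - 1 * f i"] N_scale[of f 0] N_scale[of f "-1"] scale_mem[of f "-1"]
  by simp

lemma N_comb_le:
  assumes "n \<ge> 1" "\<And>j. j \<in> {1..n} \<Longrightarrow> f j \<in> L" "\<theta> \<in> signs n"
  shows "N (signed_comb n f \<theta>) \<le> (\<Sum>j = 1..n. N (f j))"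
proof -
  have "N (signed_comb m f \<theta>) \<le> (\<Sum>j = 1..m. N (f j))" if "m \<ge> 1" "m \<le> n" for m
    using that
  proof (induction m rule: nat_induct_at_least)
    case base
    then show ?case by (simp add: signed_comb_def)
  next
    case (Suc m)
    have mem: "f (Suc m) \<in> L" "signed_comb m f \<theta> \<in> L"
      using assms(2) Suc by (auto intro!: comb_mem)
    have signed_comb: "signed_comb (Suc m) f \<theta> = (\<lambda>i. signed_comb m f \<theta> i + \<theta> (Suc m) * f (Suc m) i)"
      using Suc.hyps by (auto simp: signed_comb_def fun_eq_iff)
    have "\<bar>\<theta> (Suc m)\<bar> = 1"
      using signs_cases[OF assms(3), of "Suc m"] Suc by auto
    then show ?case
      unfolding signed_comb using N_add[OF mem(2) scale_mem[OF mem(1)], of "\<theta> (Suc m)"]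
        N_scale[OF mem(1), of "\<theta> (Suc m)"] Suc by simp
  qed
  then show ?thesis using assms(1) by blast
qed

text \<open>The triangle inequality bounds every signed sum by \<open>\<Sum>\<^sub>j N (f j)\<close>, and Cauchy-Schwarz costs the
  factor \<open>n\<close>.\<close>

lemma NJ_quot_le:
  assumes "n \<ge> 1" "x \<in> NJ_tuples n X"
  shows "NJ_quot n X x \<le> n"
proof -
  obtain f where f: "\<And>j. j \<in> {1..n} \<Longrightarrow> f j \<in> L" "\<And>j. j \<in> {1..n} \<Longrightarrow> x j = cls (f j)"
    and pos: "(\<Sum>j = 1..n. (N (f j))\<^sup>2) > 0"
    using NJ_tuples_cls[OF assms(2)] by metis
  have "(N (signed_comb n f \<theta>))\<^sup>2 \<le> n * (\<Sum>j = 1..n. (N (f j))\<^sup>2)" if "\<theta> \<in> signs n" for \<theta>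
  proof -
    have "(N (signed_comb n f \<theta>))\<^sup>2 \<le> (\<Sum>j = 1..n. N (f j))\<^sup>2"
      using N_comb_le[OF assms(1) f(1) that] N_nonneg[OF comb_mem[OF assms(1) f(1)]]
      by (intro power_mono) auto
    also have "\<dots> \<le> n * (\<Sum>j = 1..n. (N (f j))\<^sup>2)"
      using sum_squared_le_sum_of_squares[of "\<lambda>j. N (f j)" "{1..n}"] by (simp add: mult.commute)
    finally show ?thesis .
  qed
  from sum_bounded_above[of "signs n", OF this]
  have "(\<Sum>\<theta>\<in>signs n. (N (signed_comb n f \<theta>))\<^sup>2) \<le> n * (2 ^ (n - 1) * (\<Sum>j = 1..n. (N (f j))\<^sup>2))"
    by (simp add: card_signs mult_ac)
  moreover have quot: "NJ_quot n X x =
    (\<Sum>\<theta>\<in>signs n. (N (signed_comb n f \<theta>))\<^sup>2) / (2 ^ (n - 1) * (\<Sum>j = 1..n. (N (f j))\<^sup>2))"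
    by (rule NJ_quot_cls) (use assms(1) f in auto)
  ultimately show ?thesis
    unfolding quot using pos by (subst pos_divide_le_eq) simp_all
qed

text \<open>Each \<open>f j\<close> is half the sum or half the difference of two signed sums, so \<open>N (f j)\<^sup>2\<close> is at most the
  mean of their squared seminorms. Pairing up all sign patterns in this way shows that the average
  of the squared signed sums dominates every single \<open>N (f j)\<^sup>2\<close>, hence their mean.\<close>

lemma NJ_quot_ge:
  assumes "n \<ge> 1" "x \<in> NJ_tuples n X"
  shows "1 / n \<le> NJ_quot n X x"
proof -
  obtain f where f: "\<And>j. j \<in> {1..n} \<Longrightarrow> f j \<in> L" "\<And>j. j \<in> {1..n} \<Longrightarrow> x j = cls (f j)"
    and pos: "(\<Sum>j = 1..n. (N (f j))\<^sup>2) > 0"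
    using NJ_tuples_cls[OF assms(2)] by metis
  let ?S = "\<lambda>\<theta>. N (signed_comb n f \<theta>)"
  have pair: "(N (f j))\<^sup>2 \<le> ((?S \<theta>)\<^sup>2 + (?S \<eta>)\<^sup>2) / 2"
    if "j \<in> {1..n}" and c: "\<bar>c\<bar> = 1 / 2" "\<bar>d\<bar> = 1 / 2"
      and eq: "f j = (\<lambda>i. c * signed_comb n f \<theta> i + d * signed_comb n f \<eta> i)" for j c d \<theta> \<eta>
  proof -
    have mem: "signed_comb n f \<theta> \<in> L" for \<theta>
      using assms(1) f(1) by (intro comb_mem) auto
    have "N (f j) \<le> N (\<lambda>i. c * signed_comb n f \<theta> i) + N (\<lambda>i. d * signed_comb n f \<eta> i)"
      by (subst eq) (intro N_add scale_mem mem; simp)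
    then have "N (f j) \<le> (?S \<theta> + ?S \<eta>) / 2"
      unfolding N_scale[OF mem] c by simp
    then have "(N (f j))\<^sup>2 \<le> ((?S \<theta> + ?S \<eta>) / 2)\<^sup>2"
      using N_nonneg[OF f(1)[OF that(1)]] by (intro power_mono) auto
    also have "\<dots> \<le> ((?S \<theta>)\<^sup>2 + (?S \<eta>)\<^sup>2) / 2"
      using zero_le_power2[of "?S \<theta> - ?S \<eta>"] by (simp add: power2_eq_square field_simps)
    finally show ?thesis .
  qed
  have one: "2 ^ (n - 1) * (N (f j))\<^sup>2 \<le> (\<Sum>\<theta>\<in>signs n. (?S \<theta>)\<^sup>2)" if j: "j \<in> {1..n}" for j
  proof (cases "j = 1")
    case True
    \<comment> \<open>The first vector never carries a sign: it survives when all the other signs are reversed.\<close>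
    let ?flip = "\<lambda>\<theta>::nat \<Rightarrow> real. restrict (\<lambda>j. - \<theta> j) {2..n}"
    have "f j = (\<lambda>i. 1 / 2 * signed_comb n f \<theta> i + 1 / 2 * signed_comb n f (?flip \<theta>) i)" for \<theta>
      using True by (auto simp: signed_comb_def fun_eq_iff sum_negf field_simps)
    then have "(N (f j))\<^sup>2 \<le> ((?S \<theta>)\<^sup>2 + (?S (?flip \<theta>))\<^sup>2) / 2" for \<theta>
      by (intro pair[OF j, of "1/2" "1/2"]) auto
    then have "(\<Sum>\<theta>\<in>signs n. (N (f j))\<^sup>2) \<le> (\<Sum>\<theta>\<in>signs n. ((?S \<theta>)\<^sup>2 + (?S (?flip \<theta>))\<^sup>2) / 2)"
      by (intro sum_mono)
    also have "\<dots> = (\<Sum>\<theta>\<in>signs n. (?S \<theta>)\<^sup>2)"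
      using sum_flip_all_signs[of "\<lambda>\<theta>. (?S \<theta>)\<^sup>2" n]
      by (simp add: sum.distrib flip: sum_divide_distrib)
    finally show ?thesis by (simp add: card_signs)
  next
    case False
    then have j2: "j \<in> {2..n}" using j by auto
    \<comment> \<open>Reversing the sign of \<open>f j\<close> alone isolates it in the difference.\<close>
    let ?flip = "\<lambda>\<theta>::nat \<Rightarrow> real. \<theta>(j := - \<theta> j)"
    have "(N (f j))\<^sup>2 \<le> ((?S \<theta>)\<^sup>2 + (?S (?flip \<theta>))\<^sup>2) / 2" if "\<theta> \<in> signs n" for \<theta>
    proof (rule pair[OF j, of "\<theta> j / 2" "- \<theta> j / 2"])
      have split: "(\<Sum>k = 2..n. \<eta> k * f k i) = \<eta> j * f j i + (\<Sum>k\<in>{2..n} - {j}. \<eta> k * f k i)"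
        for \<eta> i using j2 by (subst sum.remove) auto
      have rest: "(\<Sum>k\<in>{2..n} - {j}. ?flip \<theta> k * f k i) = (\<Sum>k\<in>{2..n} - {j}. \<theta> k * f k i)" for i
        by (intro sum.cong) auto
      show "f j = (\<lambda>i. \<theta> j / 2 * signed_comb n f \<theta> i + - \<theta> j / 2 * signed_comb n f (?flip \<theta>) i)"
        unfolding signed_comb_def split rest using signs_cases[OF that j2]
        by (auto simp: fun_eq_iff field_simps)
    qed (use signs_cases[OF that j2] in auto)
    then have "(\<Sum>\<theta>\<in>signs n. (N (f j))\<^sup>2) \<le> (\<Sum>\<theta>\<in>signs n. ((?S \<theta>)\<^sup>2 + (?S (?flip \<theta>))\<^sup>2) / 2)"
      by (intro sum_mono)
    also have "\<dots> = (\<Sum>\<theta>\<in>signs n. (?S \<theta>)\<^sup>2)"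
      using sum_flip_sign[OF j2, of "\<lambda>\<theta>. (?S \<theta>)\<^sup>2"]
      by (simp add: sum.distrib flip: sum_divide_distrib)
    finally show ?thesis by (simp add: card_signs)
  qed
  have "(\<Sum>j = 1..n. 2 ^ (n - 1) * (N (f j))\<^sup>2) \<le> n * (\<Sum>\<theta>\<in>signs n. (?S \<theta>)\<^sup>2)"
    using sum_bounded_above[of "{1..n}", OF one] by simp
  then have "1 / n * (2 ^ (n - 1) * (\<Sum>j = 1..n. (N (f j))\<^sup>2)) \<le> (\<Sum>\<theta>\<in>signs n. (?S \<theta>)\<^sup>2)"
    unfolding sum_distrib_left[symmetric] using assms(1) by (simp add: pos_divide_le_eq mult.commute)
  moreover have quot: "NJ_quot n X x =
    (\<Sum>\<theta>\<in>signs n. (N (signed_comb n f \<theta>))\<^sup>2) / (2 ^ (n - 1) * (\<Sum>j = 1..n. (N (f j))\<^sup>2))"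
    by (rule NJ_quot_cls) (use assms(1) f in auto)
  ultimately show ?thesis
    unfolding quot using pos by (subst pos_le_divide_eq) simp_all
qed

end

section \<open>Power inequalities for finite sums\<close>

lemma convex_on_powr_nonneg:
  fixes r :: real
  assumes "1 \<le> r"
  shows "convex_on {0..} (\<lambda>x. x powr r)"
proof (rule convex_onI)
  fix t x y :: real
  assume t: "0 < t" "t < 1" and xy: "x \<in> {0..}" "y \<in> {0..}"
  have scale: "(c * z) powr r \<le> c * z powr r" if "0 < c" "c < 1" "0 \<le> z" for c z :: real
  proof -
    have "c powr r \<le> c"
      using powr_le_one_le that assms by auto
    then show ?thesis
      using that by (simp add: powr_mult mult_right_mono)
  qed
  consider "x = 0" | "y = 0" | "x > 0" "y > 0"
    using xy by fastforce
  then show "((1 - t) *\<^sub>R x + t *\<^sub>R y) powr r \<le> (1 - t) * x powr r + t * y powr r"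
  proof cases
    case 1
    then show ?thesis using scale[of t y] t xy assms by simp
  next
    case 2
    then show ?thesis using scale[of "1 - t" x] t xy assms by simp
  next
    case 3
    then show ?thesis
      using convex_onD[OF powr_convex[OF assms], of t x y] t by simp
  qed
qed simp

lemma powr_sum_le_power_mean:
  fixes a :: "'j \<Rightarrow> real"
  assumes "finite J" "1 \<le> r" "\<And>j. j \<in> J \<Longrightarrow> 0 \<le> a j"
  shows "(\<Sum>j\<in>J. a j) powr r \<le> card J powr (r - 1) * (\<Sum>j\<in>J. a j powr r)"
proof (cases "J = {}")
  case False
  define m where "m = real (card J)"
  have m: "m > 0" using False assms(1) by (simp add: m_def card_gt_0_iff)
  have "(\<Sum>j\<in>J. (1 / m) *\<^sub>R a j) powr r \<le> (\<Sum>j\<in>J. 1 / m * a j powr r)"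
    by (rule convex_on_sum[OF assms(1) False convex_on_powr_nonneg[OF assms(2)]])
      (use m assms in \<open>auto simp: m_def\<close>)
  moreover have "(\<Sum>j\<in>J. (1 / m) *\<^sub>R a j) = (\<Sum>j\<in>J. a j) / m"
    by (simp add: sum_divide_distrib)
  moreover have "(\<Sum>j\<in>J. 1 / m * a j powr r) = (\<Sum>j\<in>J. a j powr r) / m"
    by (simp add: sum_divide_distrib)
  ultimately have "(\<Sum>j\<in>J. a j) powr r / m powr r \<le> (\<Sum>j\<in>J. a j powr r) / m"
    using m by (simp add: powr_divide sum_nonneg assms)
  then have "(\<Sum>j\<in>J. a j) powr r \<le> m powr r * ((\<Sum>j\<in>J. a j powr r) / m)"
    using m by (simp add: pos_divide_le_eq mult.commute)
  then show ?thesis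
    using m by (simp add: powr_diff m_def)
qed (use assms in simp)

text \<open>After division by the total, every share lies in \<open>[0, 1]\<close>, where \<open>x \<le> x\<^sup>s\<close>.\<close>

lemma powr_sum_le_sum_powr:
  fixes a :: "'j \<Rightarrow> real"
  assumes "finite J" "0 < s" "s \<le> 1" "\<And>j. j \<in> J \<Longrightarrow> 0 \<le> a j"
  shows "(\<Sum>j\<in>J. a j) powr s \<le> (\<Sum>j\<in>J. a j powr s)"
proof -
  define A where "A = (\<Sum>j\<in>J. a j)"
  have "A \<ge> 0" using assms by (simp add: A_def sum_nonneg)
  show ?thesis
  proof (cases "A = 0")
    case True
    then show ?thesis by (simp add: A_def sum_nonneg)
  next
    case False
    with \<open>A \<ge> 0\<close> have A: "A > 0" by simp
    have "A powr s * (a j / A) \<le> a j powr s" if "j \<in> J" for j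
    proof -
      have "0 \<le> a j / A" "a j / A \<le> 1"
        using A assms that member_le_sum[of j J a] by (auto simp: A_def)
      then have "(a j / A) powr 1 \<le> (a j / A) powr s"
        using assms by (intro powr_mono') auto
      moreover have "(a j / A) powr 1 = a j / A"
        using \<open>0 \<le> a j / A\<close> by (simp only: powr_one)
      ultimately have "A powr s * (a j / A) \<le> A powr s * (a j / A) powr s"
        by (intro mult_left_mono) (simp_all only: powr_ge_zero)
      also have "\<dots> = a j powr s"
        using A assms that by (simp add: powr_divide)
      finally show ?thesis .
    qed
    then have "(\<Sum>j\<in>J. A powr s * (a j / A)) \<le> (\<Sum>j\<in>J. a j powr s)"
      by (intro sum_mono)
    moreover have "(\<Sum>j\<in>J. A powr s * (a j / A)) = A powr s"
      using A by (simp add: A_def flip: sum_distrib_left sum_divide_distrib)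
    ultimately show ?thesis by (simp add: A_def)
  qed
qed

text \<open>Minkowski's inequality in \<open>\<ell>\<^sup>r(T)\<close> for the sum of the nonnegative functions \<open>f i\<close>. With \<open>l i\<close> the norm
  of \<open>f i\<close> and \<open>A = \<Sum> l i\<close>, the sum divided by \<open>A\<close> is a convex combination, with weights \<open>l i / A\<close>, of the
  normalised functions \<open>f i / l i\<close>, and \<open>x\<^sup>r\<close> is convex.\<close>

lemma minkowski_sum_powr:
  fixes f :: "'i \<Rightarrow> 't \<Rightarrow> real"
  assumes I: "finite I" and T: "finite T" and r: "1 \<le> r"
    and nonneg: "\<And>i t. i \<in> I \<Longrightarrow> t \<in> T \<Longrightarrow> 0 \<le> f i t"
  shows "(\<Sum>t\<in>T. (\<Sum>i\<in>I. f i t) powr r) \<le> (\<Sum>i\<in>I. (\<Sum>t\<in>T. f i t powr r) powr (1 / r)) powr r"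
proof -
  define l where "l i = (\<Sum>t\<in>T. f i t powr r) powr (1 / r)" for i
  \<comment> \<open>Functions of norm \<open>0\<close> vanish on \<open>T\<close> and cannot be normalised.\<close>
  define J where "J = {i \<in> I. l i > 0}"
  define A where "A = (\<Sum>i\<in>J. l i)"
  have J: "finite J" "J \<subseteq> I" using I by (auto simp: J_def)
  have zero: "f i t = 0" if "i \<in> I - J" "t \<in> T" for i t
  proof -
    have "l i = 0" using that by (auto simp: J_def l_def not_less)
    then have "(\<Sum>t\<in>T. f i t powr r) = 0" by (simp add: l_def)
    then have "f i t powr r = 0"
      using T that by (subst (asm) sum_nonneg_eq_0_iff) auto
    then show ?thesis by simp
  qed
  have sumJ: "(\<Sum>i\<in>I. f i t) = (\<Sum>i\<in>J. f i t)" if "t \<in> T" for t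
    using zero that I J by (intro sum.mono_neutral_right) auto
  have sumA: "(\<Sum>i\<in>I. l i) = A"
    unfolding A_def using I by (intro sum.mono_neutral_right) (auto simp: J_def l_def not_less)
  show ?thesis
  proof (cases "J = {}")
    case True
    then have "(\<Sum>t\<in>T. (\<Sum>i\<in>I. f i t) powr r) = 0"
      using sumJ by simp
    then show ?thesis by simp
  next
    case False
    have A: "A > 0"
      unfolding A_def using J False by (intro sum_pos) (auto simp: J_def)
    have lpos: "l i > 0" if "i \<in> J" for i
      using that by (simp add: J_def)
    have lr: "(\<Sum>t\<in>T. f i t powr r) = l i powr r" for i
      using r by (simp add: l_def powr_powr sum_nonneg)
    have "(\<Sum>i\<in>I. f i t) powr r \<le> (\<Sum>i\<in>J. A powr r * (l i / A / l i powr r) * f i t powr r)"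
      if t: "t \<in> T" for t
    proof -
      have "(\<Sum>i\<in>J. (l i / A) *\<^sub>R (f i t / l i)) powr r \<le> (\<Sum>i\<in>J. l i / A * (f i t / l i) powr r)"
      proof (rule convex_on_sum[OF J(1) False convex_on_powr_nonneg[OF r]])
        show "(\<Sum>i\<in>J. l i / A) = 1"
          using A by (simp add: A_def flip: sum_divide_distrib)
      qed (use A lpos J(2) nonneg t in \<open>auto intro!: divide_nonneg_pos less_imp_le[OF lpos]\<close>)
      also have "(\<Sum>i\<in>J. (l i / A) *\<^sub>R (f i t / l i)) = (\<Sum>i\<in>J. f i t / A)"
        using lpos by (intro sum.cong) (auto dest: lpos)
      also have "(\<Sum>i\<in>J. f i t / A) = (\<Sum>i\<in>I. f i t) / A"
        using sumJ[OF t] by (simp add: sum_divide_distrib)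
      finally have "A powr r * ((\<Sum>i\<in>I. f i t) / A) powr r
          \<le> A powr r * (\<Sum>i\<in>J. l i / A * (f i t / l i) powr r)"
        by (intro mult_left_mono) auto
      also have "A powr r * ((\<Sum>i\<in>I. f i t) / A) powr r = (\<Sum>i\<in>I. f i t) powr r"
        using A nonneg t by (simp add: powr_divide sum_nonneg)
      also have "A powr r * (\<Sum>i\<in>J. l i / A * (f i t / l i) powr r)
          = (\<Sum>i\<in>J. A powr r * (l i / A / l i powr r) * f i t powr r)"
        unfolding sum_distrib_left using lpos J(2) nonneg t
        by (intro sum.cong) (auto simp: powr_divide less_imp_le subset_iff)
      finally show ?thesis .
    qed
    then have "(\<Sum>t\<in>T. (\<Sum>i\<in>I. f i t) powr r)
        \<le> (\<Sum>t\<in>T. \<Sum>i\<in>J. A powr r * (l i / A / l i powr r) * f i t powr r)"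
      by (intro sum_mono)
    also have "\<dots> = (\<Sum>i\<in>J. A powr r * (l i / A / l i powr r) * l i powr r)"
      by (subst sum.swap) (simp only: lr flip: sum_distrib_left)
    also have "\<dots> = (\<Sum>i\<in>J. A powr r * (l i / A))"
      by (intro sum.cong) (auto dest: lpos)
    also have "\<dots> = A powr r"
      using A by (simp add: A_def flip: sum_divide_distrib sum_distrib_left)
    finally show ?thesis
      by (simp add: sumA flip: l_def)
  qed
qed

section \<open>The type inequality for exponents between 1 and 2\<close>

text \<open>Write \<open>S\<^sub>\<theta>\<close> for the signed sum. As \<open>2 / p \<ge> 1\<close>, Minkowski's inequality moves the average over
  the signs inside the sum over the coordinates. There it acts on \<open>\<bar>S\<^sub>\<theta>(i)\<bar>\<^sup>2\<close>, whose mean is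
  \<open>\<Sum>\<^sub>j \<bar>f j i\<bar>\<^sup>2\<close>. Subadditivity of \<open>x\<^bsup>p/2\<^esup>\<close> replaces its power \<open>p / 2\<close> by \<open>\<Sum>\<^sub>j \<bar>f j i\<bar>\<^sup>p\<close>, and the
  power mean inequality turns the resulting norm in \<open>\<ell>\<^sup>p\<close> over \<open>j\<close> into one in \<open>\<ell>\<^sup>2\<close>, at the price of the
  factor \<open>n\<^bsup>2/p - 1\<^esup>\<close>. The estimate is proved for the partial sums over the coordinates and passes to
  the limit.\<close>

lemma sum_signs_powr_le:
  fixes f :: "nat \<Rightarrow> nat \<Rightarrow> real"
  assumes n: "n \<ge> 1" and p: "1 \<le> p" "p \<le> 2"
    and f: "\<And>j. j \<in> {1..n} \<Longrightarrow> summable (\<lambda>i. \<bar>f j i\<bar> powr p)"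
    and S: "\<And>\<theta>. \<theta> \<in> signs n \<Longrightarrow> summable (\<lambda>i. \<bar>signed_comb n f \<theta> i\<bar> powr p)"
  shows "(\<Sum>\<theta>\<in>signs n. (\<Sum>i. \<bar>signed_comb n f \<theta> i\<bar> powr p) powr (2 / p))
    \<le> 2 ^ (n - 1) * (n powr (2 / p - 1) * (\<Sum>j = 1..n. (\<Sum>i. \<bar>f j i\<bar> powr p) powr (2 / p)))"
    (is "?lhs \<le> ?rhs")
proof (rule LIMSEQ_le_const2)
  show "(\<lambda>k. \<Sum>\<theta>\<in>signs n. (\<Sum>i<k. \<bar>signed_comb n f \<theta> i\<bar> powr p) powr (2 / p)) \<longlonglongrightarrow> ?lhs"
    using p S by (intro tendsto_sum tendsto_powr' summable_LIMSEQ)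
      (auto intro!: eventuallyI sum_nonneg)
  have r: "1 \<le> 2 / p" and s: "0 < p / 2" "p / 2 \<le> 1"
    using p by auto
  define P where "P j = (\<Sum>i. \<bar>f j i\<bar> powr p)" for j
  have "(\<Sum>\<theta>\<in>signs n. (\<Sum>i<k. \<bar>signed_comb n f \<theta> i\<bar> powr p) powr (2 / p)) \<le> ?rhs" for k
  proof -
    have "(\<Sum>\<theta>\<in>signs n. (\<Sum>i<k. \<bar>signed_comb n f \<theta> i\<bar> powr p) powr (2 / p))
        \<le> (\<Sum>i<k. (\<Sum>\<theta>\<in>signs n. (\<bar>signed_comb n f \<theta> i\<bar> powr p) powr (2 / p)) powr (1 / (2 / p))) powr (2 / p)"
      by (rule minkowski_sum_powr) (use r finite_signs in auto)
    also have "\<dots> = (\<Sum>i<k. (\<Sum>\<theta>\<in>signs n. (signed_comb n f \<theta> i)\<^sup>2) powr (p / 2)) powr (2 / p)"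
      using p by (simp add: powr_powr)
    also have "\<dots> = (\<Sum>i<k. (2 ^ (n - 1) * (\<Sum>j = 1..n. (f j i)\<^sup>2)) powr (p / 2)) powr (2 / p)"
      using sum_signs_comb_power2[OF n, of f] by (simp only:)
    also have "\<dots> \<le> ((2 ^ (n - 1)) powr (p / 2) * (\<Sum>j = 1..n. P j)) powr (2 / p)"
    proof (intro powr_mono2 sum_nonneg)
      have "(2 ^ (n - 1) * (\<Sum>j = 1..n. (f j i)\<^sup>2)) powr (p / 2)
          \<le> (2 ^ (n - 1)) powr (p / 2) * (\<Sum>j = 1..n. \<bar>f j i\<bar> powr p)" for i
      proof -
        have "(\<Sum>j = 1..n. (f j i)\<^sup>2) powr (p / 2) \<le> (\<Sum>j = 1..n. ((f j i)\<^sup>2) powr (p / 2))"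
          by (rule powr_sum_le_sum_powr) (use s in auto)
        also have "\<dots> = (\<Sum>j = 1..n. \<bar>f j i\<bar> powr p)"
        proof (intro sum.cong refl)
          fix j
          have "((f j i)\<^sup>2) powr (p / 2) = (\<bar>f j i\<bar> powr 2) powr (p / 2)"
            by simp
          also have "\<dots> = \<bar>f j i\<bar> powr p"
            by (simp only: powr_powr) simp
          finally show "((f j i)\<^sup>2) powr (p / 2) = \<bar>f j i\<bar> powr p" .
        qed
        finally show ?thesis
          by (simp add: powr_mult sum_nonneg)
      qed
      then have "(\<Sum>i<k. (2 ^ (n - 1) * (\<Sum>j = 1..n. (f j i)\<^sup>2)) powr (p / 2))
          \<le> (\<Sum>i<k. (2 ^ (n - 1)) powr (p / 2) * (\<Sum>j = 1..n. \<bar>f j i\<bar> powr p))"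
        by (intro sum_mono)
      also have "\<dots> = (2 ^ (n - 1)) powr (p / 2) * (\<Sum>j = 1..n. \<Sum>i<k. \<bar>f j i\<bar> powr p)"
        by (subst sum.swap) (simp add: sum_distrib_left)
      also have "\<dots> \<le> (2 ^ (n - 1)) powr (p / 2) * (\<Sum>j = 1..n. P j)"
        unfolding P_def using f by (intro mult_left_mono sum_mono sum_le_suminf) auto
      finally show "(\<Sum>i<k. (2 ^ (n - 1) * (\<Sum>j = 1..n. (f j i)\<^sup>2)) powr (p / 2))
          \<le> (2 ^ (n - 1)) powr (p / 2) * (\<Sum>j = 1..n. P j)" .
    qed (use p in auto)
    also have "\<dots> = 2 ^ (n - 1) * (\<Sum>j = 1..n. P j) powr (2 / p)"
      unfolding P_def using p f by (simp add: powr_mult powr_powr sum_nonneg suminf_nonneg)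
    also have "\<dots> \<le> 2 ^ (n - 1) * (card {1..n} powr (2 / p - 1) * (\<Sum>j = 1..n. P j powr (2 / p)))"
      using powr_sum_le_power_mean[of "{1..n}" "2 / p" P] r f
      by (intro mult_left_mono) (auto simp: P_def suminf_nonneg)
    also have "\<dots> = ?rhs"
      by (simp add: P_def)
    finally show ?thesis .
  qed
  then show "\<exists>N. \<forall>k\<ge>N. (\<Sum>\<theta>\<in>signs n. (\<Sum>i<k. \<bar>signed_comb n f \<theta> i\<bar> powr p) powr (2 / p)) \<le> ?rhs"
    by blast
qed

section \<open>Extremal tuples\<close>

text \<open>The extremal tuples are built from functions \<open>u k\<close> with disjoint supports: coordinate sequences
  or indicators of disjoint sets. Being linear in the coefficients \<open>a\<close>, the construction commutes with
  signed combinations, so each space only has to compute the norm of such a function.\<close>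

definition step_fun :: "nat \<Rightarrow> (nat \<Rightarrow> 'i \<Rightarrow> real) \<Rightarrow> (nat \<Rightarrow> real) \<Rightarrow> 'i \<Rightarrow> real" where
  "step_fun K u a = (\<lambda>i. \<Sum>k<K. a k * u k i)"

lemma comb_step: "signed_comb n (\<lambda>j. step_fun K u (a j)) \<theta> = step_fun K u (signed_comb n a \<theta>)"
proof
  fix i
  have "(\<Sum>j = 2..n. \<theta> j * (\<Sum>k<K. a j k * u k i)) = (\<Sum>k<K. (\<Sum>j = 2..n. \<theta> j * a j k) * u k i)"
    by (simp add: sum_distrib_left sum_distrib_right mult.assoc) (rule sum.swap)
  then show "signed_comb n (\<lambda>j. step_fun K u (a j)) \<theta> i = step_fun K u (signed_comb n a \<theta>) i"
    by (simp add: signed_comb_def step_fun_def distrib_right sum.distrib)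
qed

text \<open>The \<open>j\<close>-th vector of the standard basis. Vectors are numbered from \<open>1\<close>, coordinates from \<open>0\<close>.\<close>

definition unit_coords :: "nat \<Rightarrow> nat \<Rightarrow> real" where
  "unit_coords j k = (if k + 1 = j then 1 else 0)"

lemma abs_comb_unit_coords:
  assumes "\<theta> \<in> signs n" "k < n"
  shows "\<bar>signed_comb n unit_coords \<theta> k\<bar> = 1"
proof (cases "k = 0")
  case True
  then have "(\<Sum>j = 2..n. \<theta> j * unit_coords j k) = 0"
    by (intro sum.neutral) (auto simp: unit_coords_def)
  then show ?thesis
    using True by (simp add: signed_comb_def unit_coords_def)
next
  case False
  then have k: "k + 1 \<in> {2..n}" using assms(2) by auto
  have "(\<Sum>j = 2..n. \<theta> j * unit_coords j k) = (\<Sum>j = 2..n. if k + 1 = j then \<theta> j else 0)"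
    by (intro sum.cong) (auto simp: unit_coords_def)
  also have "\<dots> = \<theta> (k + 1)"
    using k by (subst sum.delta') auto
  finally show ?thesis
    using signs_cases[OF assms(1) k] False by (auto simp: signed_comb_def unit_coords_def)
qed

context function_model
begin

text \<open>All signed sums of the standard basis have \<open>n\<close> coordinates of modulus \<open>1\<close>, hence norm \<open>n\<^bsup>1/p\<^esup>\<close>.\<close>

lemma lp_step_witness:
  fixes p :: real
  assumes "n \<ge> 1" "p > 0" and "\<And>a. step_fun n u a \<in> L"
    and norm: "\<And>a. N (step_fun n u a) = (\<Sum>k<n. \<bar>a k\<bar> powr p) powr (1 / p)"
  shows "\<exists>x\<in>mNJ_tuples n X. NJ_quot n X x = n powr (2 / p - 1)"
proof -
  let ?f = "\<lambda>j. step_fun n u (unit_coords j)"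
  have unit: "N (?f j) = 1" if "j \<in> {1..n}" for j
  proof -
    have "(\<Sum>k<n. \<bar>unit_coords j k\<bar> powr p) = (\<Sum>k<n. if j - 1 = k then 1 else 0)"
      using that by (intro sum.cong) (auto simp: unit_coords_def)
    also have "\<dots> = 1" using that by (subst sum.delta') auto
    finally show ?thesis by (simp add: norm)
  qed
  have "N (signed_comb n ?f \<theta>) = n powr (1 / p)" if "\<theta> \<in> signs n" for \<theta>
    unfolding comb_step norm using abs_comb_unit_coords[OF that] by simp
  note witness = mNJ_witness[OF assms(1) assms(3) unit this]
  have "(n powr (1 / p))\<^sup>2 / n = n powr (2 / p - 1)"
    using assms(1) by (simp add: powr_diff power2_eq_square flip: powr_add)
  with witness show ?thesis by metis
qed

text \<open>In the supremum norm all signed sums of the standard basis stay of norm \<open>1\<close>.\<close>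

lemma sup_step_lower_witness:
  assumes "n \<ge> 1" and "\<And>a. step_fun n u a \<in> L"
    and norm: "\<And>a c. (\<And>k. k < n \<Longrightarrow> \<bar>a k\<bar> \<le> c) \<Longrightarrow> (\<exists>k<n. \<bar>a k\<bar> = c) \<Longrightarrow> N (step_fun n u a) = c"
  shows "\<exists>x\<in>mNJ_tuples n X. NJ_quot n X x = 1 / n"
proof -
  let ?f = "\<lambda>j. step_fun n u (unit_coords j)"
  have unit: "N (?f j) = 1" if "j \<in> {1..n}" for j
    using that by (intro norm) (auto simp: unit_coords_def intro!: exI[of _ "j - 1"])
  have "N (signed_comb n ?f \<theta>) = 1" if "\<theta> \<in> signs n" for \<theta>
    unfolding comb_step using abs_comb_unit_coords[OF that] assms(1)
    by (intro norm) (auto intro!: exI[of _ 0])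
  note witness = mNJ_witness[OF assms(1) assms(2) unit this]
  then show ?thesis by (metis power_one)
qed

text \<open>With one coordinate for each sign pattern \<open>\<theta>\<close>, let the \<open>j\<close>-th vector have the entry \<open>\<theta>\<^sub>j\<close> at \<open>\<theta>\<close>.
  The signed sum with signs \<open>\<theta>\<close> then attains the value \<open>n\<close> at the coordinate \<open>\<theta>\<close>.\<close>

lemma sup_step_upper_witness:
  assumes "n \<ge> 1" and "\<And>a. step_fun (2 ^ (n - 1)) u a \<in> L"
    and norm: "\<And>a c. (\<And>k. k < 2 ^ (n - 1) \<Longrightarrow> \<bar>a k\<bar> \<le> c) \<Longrightarrow> (\<exists>k<2 ^ (n - 1). \<bar>a k\<bar> = c) \<Longrightarrow>
      N (step_fun (2 ^ (n - 1)) u a) = c"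
  shows "\<exists>x\<in>mNJ_tuples n X. NJ_quot n X x = n"
proof -
  obtain e where "bij_betw e {0..<card (signs n)} (signs n)"
    using ex_bij_betw_nat_finite[OF finite_signs[of n]] by blast
  then have e: "e ` {..<2 ^ (n - 1)} = signs n"
    by (simp add: bij_betw_def card_signs lessThan_atLeast0)
  define a where "a j k = (if j = 1 then 1 else e k j)" for j k
  have abs_a: "\<bar>a j k\<bar> = 1" if "j \<in> {1..n}" "k < 2 ^ (n - 1)" for j k
  proof (cases "j = 1")
    case False
    have "e k \<in> signs n" using e that(2) by blast
    then show ?thesis
      using signs_cases[of "e k" n j] that(1) False by (auto simp: a_def)
  qed (simp add: a_def)
  let ?f = "\<lambda>j. step_fun (2 ^ (n - 1)) u (a j)"
  have unit: "N (?f j) = 1" if "j \<in> {1..n}" for j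
    using abs_a[OF that] by (intro norm) (auto intro!: exI[of _ 0])
  have "N (signed_comb n ?f \<theta>) = n" if \<theta>: "\<theta> \<in> signs n" for \<theta>
    unfolding comb_step
  proof (rule norm)
    fix k :: nat assume k: "k < 2 ^ (n - 1)"
    have "\<bar>signed_comb n a \<theta> k\<bar> \<le> \<bar>a 1 k\<bar> + (\<Sum>j = 2..n. \<bar>\<theta> j * a j k\<bar>)"
      unfolding signed_comb_def by (intro order_trans[OF abs_triangle_ineq] add_left_mono sum_abs)
    also have "(\<Sum>j = 2..n. \<bar>\<theta> j * a j k\<bar>) = (\<Sum>j = 2..n. 1)"
    proof (intro sum.cong refl)
      fix j assume "j \<in> {2..n}"
      then show "\<bar>\<theta> j * a j k\<bar> = 1"
        using abs_a[OF _ k, of j] signs_cases[OF \<theta>, of j] by (auto simp: abs_mult)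
    qed
    also have "\<bar>a 1 k\<bar> + (\<Sum>j = 2..n. 1) = n"
      using abs_a[OF _ k, of 1] assms(1) by (simp add: of_nat_diff)
    finally show "\<bar>signed_comb n a \<theta> k\<bar> \<le> n" .
  next
    have "\<theta> \<in> e ` {..<2 ^ (n - 1)}"
      using \<theta> unfolding e .
    then obtain k where k: "k < 2 ^ (n - 1)" "e k = \<theta>"
      by auto
    have "(\<Sum>j = 2..n. \<theta> j * a j k) = (\<Sum>j = 2..n. 1)"
    proof (intro sum.cong refl)
      fix j assume "j \<in> {2..n}"
      then show "\<theta> j * a j k = 1"
        using signs_cases[OF \<theta>, of j] k by (auto simp: a_def)
    qed
    then have "signed_comb n a \<theta> k = n"
      using assms(1) by (simp add: signed_comb_def a_def of_nat_diff)
    then show "\<exists>k<2 ^ (n - 1). \<bar>signed_comb n a \<theta> k\<bar> = n"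
      using k by auto
  qed
  note witness = mNJ_witness[OF assms(1) assms(2) unit this]
  moreover have "(real n)\<^sup>2 / n = n" using assms(1) by (simp add: power2_eq_square)
  ultimately show ?thesis by metis
qed

end

section \<open>The sequence spaces\<close>

abbreviation coords :: "nat \<Rightarrow> nat \<Rightarrow> real" where
  "coords \<equiv> \<lambda>k. indicator {k}"

lemma step_coords: "step_fun K coords a = (\<lambda>i. if i < K then a i else 0)"
proof
  fix i
  have "(\<Sum>k<K. a k * indicator {k} i) = (\<Sum>k<K. if i = k then a k else 0)"
    by (intro sum.cong) (auto simp: indicator_def)
  then show "step_fun K coords a i = (if i < K then a i else 0)"
    by (simp add: step_fun_def)
qed

lemma step_coords_vanishes: "enat K \<le> d \<Longrightarrow> d \<le> enat i \<Longrightarrow> step_fun K coords a i = 0"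
  by (metis enat_ord_simps(1) linorder_not_less order_trans step_coords)

lemma lp_set_finite_iff:
  "x \<in> lp_set (ereal p) d \<longleftrightarrow> (\<forall>i. d \<le> enat i \<longrightarrow> x i = 0) \<and> summable (\<lambda>i. \<bar>x i\<bar> powr p)"
  by (simp add: lp_set_def)

lemma lp_space_model:
  assumes "1 \<le> p"
  shows "function_model (lp_space (ereal p) d) (lp_set (ereal p) d) (lp_norm (ereal p)) id"
proof
  fix f g assume f: "f \<in> lp_set (ereal p) d" and g: "g \<in> lp_set (ereal p) d"
  have "\<bar>f i + g i\<bar> powr p \<le> 2 powr (p - 1) * (\<bar>f i\<bar> powr p + \<bar>g i\<bar> powr p)" for i
  proof -
    have "\<bar>f i + g i\<bar> powr p \<le> (\<bar>f i\<bar> + \<bar>g i\<bar>) powr p"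
      using assms by (intro powr_mono2) auto
    also have "\<dots> \<le> 2 powr (p - 1) * (\<bar>f i\<bar> powr p + \<bar>g i\<bar> powr p)"
      using powr_sum_le_power_mean[of UNIV p "\<lambda>b. if b then \<bar>f i\<bar> else \<bar>g i\<bar>"] assms
      by (simp add: UNIV_bool add.commute)
    finally show ?thesis .
  qed
  note bound = this
  have summ: "summable (\<lambda>i. 2 powr (p - 1) * (\<bar>f i\<bar> powr p + \<bar>g i\<bar> powr p))"
    using f g by (intro summable_mult summable_add) (auto simp: lp_set_finite_iff)
  have "summable (\<lambda>i. \<bar>f i + g i\<bar> powr p)"
    by (rule summable_comparison_test'[OF summ, of 0]) (simp add: bound)
  then show "(\<lambda>i. f i + g i) \<in> lp_set (ereal p) d"
    using f g by (simp add: lp_set_finite_iff)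
next
  fix f c assume "f \<in> lp_set (ereal p) d"
  then show "(\<lambda>i. c * f i) \<in> lp_set (ereal p) d"
    by (simp add: lp_set_finite_iff abs_mult powr_mult summable_mult)
qed (simp_all add: lp_space_def)

lemma lp_upper_constants:
  assumes n: "n \<ge> 1" and p: "1 \<le> p" "p \<le> 2" and d: "enat n \<le> d"
  shows "upper_NJ n (lp_space (ereal p) d) = n powr (2 / p - 1) \<and>
    upper_mNJ n (lp_space (ereal p) d) = n powr (2 / p - 1)"
proof -
  interpret function_model "lp_space (ereal p) d" "lp_set (ereal p) d" "lp_norm (ereal p)" id
    using lp_space_model[OF p(1)] .
  have norm: "lp_norm (ereal p) x = (\<Sum>i. \<bar>x i\<bar> powr p) powr (1 / p)" for x
    by (simp add: lp_norm_def)
  have norm2: "(lp_norm (ereal p) x)\<^sup>2 = (\<Sum>i. \<bar>x i\<bar> powr p) powr (2 / p)" for x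
    unfolding norm power2_eq_square by (simp flip: powr_add)
  have step_norm: "(\<lambda>i. \<bar>step_fun n coords a i\<bar> powr p) sums (\<Sum>k<n. \<bar>a k\<bar> powr p)" for a
  proof -
    have "\<bar>step_fun n coords a i\<bar> powr p = (if i \<in> {..<n} then \<bar>a i\<bar> powr p else 0)" for i
      by (simp add: step_coords)
    then show ?thesis
      by (simp only: sums_If_finite_set finite_lessThan)
  qed
  have "\<exists>x\<in>mNJ_tuples n (lp_space (ereal p) d). NJ_quot n (lp_space (ereal p) d) x = n powr (2 / p - 1)"
  proof (rule lp_step_witness)
    fix a
    show "step_fun n coords a \<in> lp_set (ereal p) d"
      using step_norm[of a] step_coords_vanishes[OF d] by (auto simp: lp_set_finite_iff sums_iff)
    show "lp_norm (ereal p) (step_fun n coords a) = (\<Sum>k<n. \<bar>a k\<bar> powr p) powr (1 / p)"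
      using step_norm[of a] by (simp add: norm sums_iff)
  qed (use n p in auto)
  then obtain x where x: "x \<in> mNJ_tuples n (lp_space (ereal p) d)"
    "NJ_quot n (lp_space (ereal p) d) x = n powr (2 / p - 1)"
    by blast
  show ?thesis
  proof (rule upper_constants_eqI[OF n x])
    fix y assume "y \<in> NJ_tuples n (lp_space (ereal p) d)"
    then obtain f where f: "\<And>j. j \<in> {1..n} \<Longrightarrow> f j \<in> lp_set (ereal p) d"
      "\<And>j. j \<in> {1..n} \<Longrightarrow> y j = id (f j)"
      and pos: "(\<Sum>j = 1..n. (lp_norm (ereal p) (f j))\<^sup>2) > 0"
      using NJ_tuples_cls by blast
    have quot: "NJ_quot n (lp_space (ereal p) d) y = (\<Sum>\<theta>\<in>signs n. (lp_norm (ereal p) (signed_comb n f \<theta>))\<^sup>2)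
        / (2 ^ (n - 1) * (\<Sum>j = 1..n. (lp_norm (ereal p) (f j))\<^sup>2))"
      by (rule NJ_quot_cls) (use n f in auto)
    have "signed_comb n f \<theta> \<in> lp_set (ereal p) d" for \<theta>
      using n f by (intro comb_mem) auto
    then have "(\<Sum>\<theta>\<in>signs n. (lp_norm (ereal p) (signed_comb n f \<theta>))\<^sup>2)
      \<le> 2 ^ (n - 1) * (n powr (2 / p - 1) * (\<Sum>j = 1..n. (lp_norm (ereal p) (f j))\<^sup>2))"
      unfolding norm2 using n p f(1)
      by (intro sum_signs_powr_le) (auto simp: lp_set_finite_iff)
    then show "NJ_quot n (lp_space (ereal p) d) y \<le> n powr (2 / p - 1)"
      unfolding quot using pos by (subst pos_divide_le_eq) (simp_all add: mult_ac)
  qed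
qed

lemma linf_set_iff:
  "x \<in> lp_set \<infinity> d \<longleftrightarrow> (\<forall>i. d \<le> enat i \<longrightarrow> x i = 0) \<and> bdd_above (range (\<lambda>i. \<bar>x i\<bar>))"
  by (simp add: lp_set_def)

lemma linf_norm_upper: "x \<in> lp_set \<infinity> d \<Longrightarrow> \<bar>x i\<bar> \<le> lp_norm \<infinity> x"
  by (auto simp: linf_set_iff lp_norm_def intro!: cSUP_upper)

lemma linf_norm_least: "(\<And>i. \<bar>x i\<bar> \<le> c) \<Longrightarrow> lp_norm \<infinity> x \<le> c"
  by (auto simp: lp_norm_def intro!: cSUP_least)

lemma linf_setI: "(\<And>i. d \<le> enat i \<Longrightarrow> x i = 0) \<Longrightarrow> (\<And>i. \<bar>x i\<bar> \<le> c) \<Longrightarrow> x \<in> lp_set \<infinity> d"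
  by (auto simp: linf_set_iff intro!: bdd_aboveI)

lemma linf_space_model: "seminorm_model (lp_space \<infinity> d) (lp_set \<infinity> d) (lp_norm \<infinity>) id"
proof
  fix f g assume f: "f \<in> lp_set \<infinity> d" and g: "g \<in> lp_set \<infinity> d"
  have bound: "\<bar>f i + g i\<bar> \<le> lp_norm \<infinity> f + lp_norm \<infinity> g" for i
    using linf_norm_upper[OF f, of i] linf_norm_upper[OF g, of i] by linarith
  show "(\<lambda>i. f i + g i) \<in> lp_set \<infinity> d"
    using f g by (intro linf_setI[OF _ bound]) (auto simp: linf_set_iff)
  show "lp_norm \<infinity> (\<lambda>i. f i + g i) \<le> lp_norm \<infinity> f + lp_norm \<infinity> g"
    using bound by (rule linf_norm_least)
next
  fix f c assume f: "f \<in> lp_set \<infinity> d"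
  have bound: "\<bar>c * f i\<bar> \<le> \<bar>c\<bar> * lp_norm \<infinity> f" for i
    using linf_norm_upper[OF f, of i] by (simp add: abs_mult mult_left_mono)
  show mem: "(\<lambda>i. c * f i) \<in> lp_set \<infinity> d"
    using f by (intro linf_setI[OF _ bound]) (auto simp: linf_set_iff)
  show "lp_norm \<infinity> (\<lambda>i. c * f i) = \<bar>c\<bar> * lp_norm \<infinity> f"
  proof (rule antisym[OF linf_norm_least[OF bound]])
    show "\<bar>c\<bar> * lp_norm \<infinity> f \<le> lp_norm \<infinity> (\<lambda>i. c * f i)"
    proof (cases "c = 0")
      case False
      then have "\<bar>f i\<bar> \<le> lp_norm \<infinity> (\<lambda>i. c * f i) / \<bar>c\<bar>" for i
        using linf_norm_upper[OF mem, of i] by (simp add: abs_mult field_simps)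
      then have "lp_norm \<infinity> f \<le> lp_norm \<infinity> (\<lambda>i. c * f i) / \<bar>c\<bar>"
        by (rule linf_norm_least)
      then show ?thesis using False by (simp add: field_simps)
    qed (simp add: lp_norm_def)
  qed
qed (simp_all add: lp_space_def)

lemma linf_step_mem: "enat K \<le> d \<Longrightarrow> step_fun K coords a \<in> lp_set \<infinity> d"
proof (rule linf_setI)
  fix i
  show "\<bar>step_fun K coords a i\<bar> \<le> (\<Sum>k<K. \<bar>a k\<bar>)"
    by (auto simp: step_coords intro!: member_le_sum sum_nonneg)
qed (rule step_coords_vanishes)

lemma linf_step_norm:
  assumes "\<And>k. k < K \<Longrightarrow> \<bar>a k\<bar> \<le> c" and "\<exists>k<K. \<bar>a k\<bar> = c"
  shows "lp_norm \<infinity> (step_fun K coords a) = c"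
proof (rule antisym)
  obtain k where k: "k < K" "\<bar>a k\<bar> = c" using assms(2) by blast
  show "lp_norm \<infinity> (step_fun K coords a) \<le> c"
    using assms(1) k(2) by (intro linf_norm_least) (auto simp: step_coords)
  have "\<bar>step_fun K coords a k\<bar> \<le> lp_norm \<infinity> (step_fun K coords a)"
    using linf_step_mem[of K "enat K"] by (intro linf_norm_upper) auto
  then show "c \<le> lp_norm \<infinity> (step_fun K coords a)"
    using k by (simp add: step_coords)
qed

section \<open>The function spaces\<close>

text \<open>Split off from \<open>B\<close> a set \<open>C\<close> of strictly smaller positive measure, and repeat inside \<open>B - C\<close>. Strictness
  makes \<open>C\<close> of finite measure and leaves \<open>B - C\<close> with positive measure.\<close>

lemma nonatomic_disjoint_sets:
  fixes K :: nat
  assumes "nonatomic M" "B \<in> sets M" "emeasure M B > 0"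
  shows "\<exists>A. disjoint_family_on A {..<K} \<and>
    (\<forall>k<K. A k \<in> sets M \<and> A k \<subseteq> B \<and> 0 < emeasure M (A k) \<and> emeasure M (A k) < \<infinity>)"
  using assms(2,3)
proof (induction K arbitrary: B)
  case 0
  then show ?case by (simp add: disjoint_family_on_def)
next
  case (Suc K)
  obtain C where C: "C \<in> sets M" "C \<subseteq> B" "0 < emeasure M C" "emeasure M C < emeasure M B"
    using assms(1) Suc.prems unfolding nonatomic_def by blast
  have fin: "emeasure M C < \<infinity>"
    using C(4) by (simp add: order_less_le_trans)
  have "emeasure M (B - C) > 0"
    using C Suc.prems fin by (subst emeasure_Diff) (auto simp: diff_gr0_ennreal)
  moreover have "B - C \<in> sets M" using C Suc.prems by auto
  ultimately obtain A where A: "disjoint_family_on A {..<K}"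
    "\<forall>k<K. A k \<in> sets M \<and> A k \<subseteq> B - C \<and> 0 < emeasure M (A k) \<and> emeasure M (A k) < \<infinity>"
    using Suc.IH by blast
  have "disjoint_family_on (A(K := C)) {..<Suc K}"
    using A unfolding disjoint_family_on_def by (auto simp: less_Suc_eq) blast
  moreover have "\<forall>k<Suc K. (A(K := C)) k \<in> sets M \<and> (A(K := C)) k \<subseteq> B \<and>
      0 < emeasure M ((A(K := C)) k) \<and> emeasure M ((A(K := C)) k) < \<infinity>"
    using A(2) C fin by (auto simp: less_Suc_eq)
  ultimately show ?case by blast
qed

lemma ae_quotient_model:
  assumes "L \<subseteq> borel_measurable M"
    and "\<And>f. f \<in> L \<Longrightarrow> rnorm (ae_quotient M L N) (ae_rel M `` {f}) = N f"
    and "\<And>f g. f \<in> L \<Longrightarrow> g \<in> L \<Longrightarrow> (\<lambda>x. f x + g x) \<in> L"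
    and "\<And>f c. f \<in> L \<Longrightarrow> (\<lambda>x. c * f x) \<in> L"
  shows "function_model (ae_quotient M L N) L N (\<lambda>f. ae_rel M `` {f})"
proof
  show "rcarrier (ae_quotient M L N) = (\<lambda>f. ae_rel M `` {f}) ` L"
    by (auto simp: ae_quotient_def quotient_def)
qed (use assms in \<open>auto simp: radd_ae_class rscale_ae_class subset_iff\<close>)

lemma L1_space_model:
  "seminorm_model (L1_space M) {f. integrable M f} (\<lambda>f. \<integral>x. \<bar>f x\<bar> \<partial>M) (\<lambda>f. ae_rel M `` {f})"
proof (intro seminorm_model.intro seminorm_model_axioms.intro)
  show "function_model (L1_space M) {f. integrable M f} (\<lambda>f. \<integral>x. \<bar>f x\<bar> \<partial>M) (\<lambda>f. ae_rel M `` {f})"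
    unfolding L1_space_def
    by (rule ae_quotient_model) (auto simp flip: L1_space_def simp: rnorm_L1_class)
next
  fix f g :: "'a \<Rightarrow> real" assume "f \<in> {f. integrable M f}" "g \<in> {f. integrable M f}"
  then have [simp]: "integrable M f" "integrable M g" by simp_all
  have "(\<integral>x. \<bar>f x + g x\<bar> \<partial>M) \<le> (\<integral>x. \<bar>f x\<bar> + \<bar>g x\<bar> \<partial>M)"
    by (intro integral_mono) auto
  then show "(\<integral>x. \<bar>f x + g x\<bar> \<partial>M) \<le> (\<integral>x. \<bar>f x\<bar> \<partial>M) + (\<integral>x. \<bar>g x\<bar> \<partial>M)"
    by simp
qed (simp add: abs_mult)

text \<open>Over a null space the essential supremum of \<open>\<bar>f\<bar>\<close> would be \<open>-\<infinity>\<close>; here it is at least that of the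
  constant \<open>0\<close>, which is \<open>0\<close>.\<close>

lemma Linf_esssup:
  assumes "emeasure M (space M) > 0" "f \<in> borel_measurable M" "esssup M (\<lambda>x. ereal \<bar>f x\<bar>) < \<infinity>"
  shows "esssup M (\<lambda>x. ereal \<bar>f x\<bar>) = ereal (real_of_ereal (esssup M (\<lambda>x. ereal \<bar>f x\<bar>)))"
proof -
  have "0 = esssup M (\<lambda>x. 0 :: ereal)"
    using assms(1) by (subst esssup_const) auto
  also have "\<dots> \<le> esssup M (\<lambda>x. ereal \<bar>f x\<bar>)"
    by (intro esssup_mono) auto
  finally show ?thesis
    using assms(3) by (cases "esssup M (\<lambda>x. ereal \<bar>f x\<bar>)") auto
qed

abbreviation Linf_set :: "'a measure \<Rightarrow> ('a \<Rightarrow> real) set" where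
  "Linf_set M \<equiv> {f \<in> borel_measurable M. esssup M (\<lambda>x. ereal \<bar>f x\<bar>) < \<infinity>}"

lemma Linf_space_model:
  assumes pos: "emeasure M (space M) > 0"
  shows "seminorm_model (Linf_space M) (Linf_set M)
    (\<lambda>f. real_of_ereal (esssup M (\<lambda>x. ereal \<bar>f x\<bar>))) (\<lambda>f. ae_rel M `` {f})"
proof -
  let ?E = "\<lambda>f. esssup M (\<lambda>x. ereal \<bar>f x\<bar>)"
  have add: "?E (\<lambda>x. f x + g x) \<le> ?E f + ?E g"
    if [measurable]: "f \<in> borel_measurable M" "g \<in> borel_measurable M" for f g
  proof -
    have "?E (\<lambda>x. f x + g x) \<le> esssup M (\<lambda>x. ereal \<bar>f x\<bar> + ereal \<bar>g x\<bar>)"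
      by (intro esssup_mono) auto
    also have "\<dots> \<le> ?E f + ?E g"
      by (rule esssup_add)
    finally show ?thesis .
  qed
  have scale: "?E (\<lambda>x. c * f x) = ereal \<bar>c\<bar> * ?E f" if "f \<in> borel_measurable M" for f c
  proof (cases "c = 0")
    case True
    then show ?thesis
      using pos esssup_const[of M "0 :: ereal"] by (simp flip: zero_ereal_def)
  next
    case False
    then show ?thesis
      using esssup_cmult[of "\<bar>c\<bar>" M "\<lambda>x. ereal \<bar>f x\<bar>"] by (simp add: abs_mult)
  qed
  show ?thesis
  proof (intro seminorm_model.intro seminorm_model_axioms.intro)
    show "function_model (Linf_space M) (Linf_set M) (\<lambda>f. real_of_ereal (?E f)) (\<lambda>f. ae_rel M `` {f})"
      unfolding Linf_space_def
    proof (rule ae_quotient_model)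
      fix f g assume fg: "f \<in> Linf_set M" "g \<in> Linf_set M"
      then have "?E f + ?E g < \<infinity>" by auto
      then show "(\<lambda>x. f x + g x) \<in> Linf_set M"
        using fg add[of f g] by auto
    next
      fix f c assume f: "f \<in> Linf_set M"
      then have fin: "?E f = ereal (real_of_ereal (?E f))"
        using Linf_esssup[OF pos] by blast
      have "?E (\<lambda>x. c * f x) < \<infinity>"
        using f by (subst scale, simp, subst fin) simp
      then show "(\<lambda>x. c * f x) \<in> Linf_set M"
        using f by (auto intro!: borel_measurable_times)
    qed (auto intro!: rnorm_Linf_class[unfolded Linf_space_def] simp del: ereal_infty_less)
  next
    fix f g assume fg: "f \<in> Linf_set M" "g \<in> Linf_set M"
    then have fin: "?E f = ereal (real_of_ereal (?E f))" "?E g = ereal (real_of_ereal (?E g))"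
      using Linf_esssup[OF pos] by blast+
    have "?E (\<lambda>x. f x + g x) \<le> ereal (real_of_ereal (?E f)) + ereal (real_of_ereal (?E g))"
      unfolding fin[symmetric] using add fg by blast
    then have le: "?E (\<lambda>x. f x + g x) \<le> ereal (real_of_ereal (?E f) + real_of_ereal (?E g))"
      by simp
    then have "?E (\<lambda>x. f x + g x) < \<infinity>"
      by (rule order.strict_trans1) simp
    then obtain r where r: "?E (\<lambda>x. f x + g x) = ereal r"
      using Linf_esssup[OF pos, of "\<lambda>x. f x + g x"] fg by auto
    show "real_of_ereal (?E (\<lambda>x. f x + g x)) \<le> real_of_ereal (?E f) + real_of_ereal (?E g)"
      using le unfolding r by simp
  next
    fix f c assume "f \<in> Linf_set M"
    then show "real_of_ereal (?E (\<lambda>x. c * f x)) = \<bar>c\<bar> * real_of_ereal (?E f)"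
      using scale[of f c] by simp
  qed
qed

lemma step_disjoint_support:
  assumes "disjoint_family_on A {..<K}" and "\<And>k x. x \<notin> A k \<Longrightarrow> u k x = 0"
  shows "m < K \<Longrightarrow> x \<in> A m \<Longrightarrow> step_fun K u a x = a m * u m x"
    and "\<forall>k<K. x \<notin> A k \<Longrightarrow> step_fun K u a x = 0"
proof -
  assume m: "m < K" "x \<in> A m"
  have "a k * u k x = (if m = k then a m * u m x else 0)" if "k < K" for k
  proof (cases "m = k")
    case False
    then have "x \<notin> A k"
      using disjoint_family_onD[OF assms(1), of m k] m that by auto
    then show ?thesis
      using False assms(2) by simp
  qed simp
  then have "step_fun K u a x = (\<Sum>k<K. if m = k then a m * u m x else 0)"
    unfolding step_fun_def by (intro sum.cong) auto
  then show "step_fun K u a x = a m * u m x"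
    using m by simp
qed (simp add: step_fun_def assms(2))

text \<open>Disjoint indicators scaled to integral \<open>1\<close> span a copy of \<open>l\<^sup>1\<^sub>K\<close>, so the extremal tuple is that of \<open>l\<^sup>p\<close> for
  \<open>p = 1\<close>.\<close>

lemma L1_step:
  fixes a :: "nat \<Rightarrow> real"
  assumes disj: "disjoint_family_on A {..<K}"
    and A: "\<And>k. k < K \<Longrightarrow> A k \<in> sets M \<and> 0 < emeasure M (A k) \<and> emeasure M (A k) < \<infinity>"
  defines "u \<equiv> \<lambda>k x. indicator (A k) x / measure M (A k)"
  shows "integrable M (step_fun K u a)" and "(\<integral>x. \<bar>step_fun K u a x\<bar> \<partial>M) = (\<Sum>k<K. \<bar>a k\<bar>)"
proof -
  have u: "integrable M (u k) \<and> (\<integral>x. u k x \<partial>M) = 1" if "k < K" for k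
  proof -
    have "measure M (A k) > 0"
      using A[OF that] by (simp add: measure_def enn2real_positive_iff)
    then show ?thesis
      using A[OF that] sets.sets_into_space[of "A k" M]
      by (auto simp: u_def Int_absorb2 Int_absorb1 intro!: integrable_real_indicator)
  qed
  show "integrable M (step_fun K u a)"
    unfolding step_fun_def using u by (intro Bochner_Integration.integrable_sum integrable_mult_right) auto
  have abs_step: "\<bar>step_fun K u a x\<bar> = step_fun K u (\<lambda>k. \<bar>a k\<bar>) x" for x
  proof (cases "\<exists>m<K. x \<in> A m")
    case True
    then obtain m where m: "m < K" "x \<in> A m" by blast
    have "step_fun K u b x = b m * u m x" for b
      using step_disjoint_support(1)[OF disj _ m, of u] by (simp add: u_def)
    then show ?thesis
      by (simp add: abs_mult u_def)
  next
    case False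
    then have "step_fun K u b x = 0" for b
      using step_disjoint_support(2)[OF disj, of u x] by (simp add: u_def)
    then show ?thesis by simp
  qed
  show "(\<integral>x. \<bar>step_fun K u a x\<bar> \<partial>M) = (\<Sum>k<K. \<bar>a k\<bar>)"
    unfolding abs_step unfolding step_fun_def using u
    by (subst Bochner_Integration.integral_sum) auto
qed

lemma Linf_step:
  fixes a :: "nat \<Rightarrow> real" and c :: real
  assumes disj: "disjoint_family_on A {..<K}"
    and A: "\<And>k. k < K \<Longrightarrow> A k \<in> sets M \<and> 0 < emeasure M (A k)"
  defines "s \<equiv> step_fun K (\<lambda>k. indicator (A k)) a"
  shows "s \<in> Linf_set M"
    and "(\<And>k. k < K \<Longrightarrow> \<bar>a k\<bar> \<le> c) \<Longrightarrow> \<exists>k<K. \<bar>a k\<bar> = c \<Longrightarrow>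
      real_of_ereal (esssup M (\<lambda>x. ereal \<bar>s x\<bar>)) = c"
proof -
  have [measurable]: "s \<in> borel_measurable M"
    unfolding s_def step_fun_def using A by (intro borel_measurable_sum borel_measurable_times borel_measurable_indicator) auto
  have s: "s x = a k" if "k < K" "x \<in> A k" for k x
    using step_disjoint_support(1)[OF disj _ that, of "\<lambda>k. indicator (A k)" a] that by (simp add: s_def)
  have s0: "s x = 0" if "\<forall>k<K. x \<notin> A k" for x
    using step_disjoint_support(2)[OF disj _ that, of "\<lambda>k. indicator (A k)" a] by (simp add: s_def)
  have le: "esssup M (\<lambda>x. ereal \<bar>s x\<bar>) \<le> ereal c"
    if "\<And>k. k < K \<Longrightarrow> \<bar>a k\<bar> \<le> c" "0 \<le> c" for c
  proof (intro esssup_I AE_I2)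
    fix x
    show "ereal \<bar>s x\<bar> \<le> ereal c"
      using s[of _ x] s0[of x] that by (cases "\<exists>k<K. x \<in> A k") auto
  qed auto
  have "esssup M (\<lambda>x. ereal \<bar>s x\<bar>) \<le> ereal (\<Sum>k<K. \<bar>a k\<bar>)"
    by (intro le) (auto intro!: member_le_sum sum_nonneg)
  then have "esssup M (\<lambda>x. ereal \<bar>s x\<bar>) < \<infinity>"
    by (rule order.strict_trans1) simp
  then show "s \<in> Linf_set M"
    by simp
  have eq: "esssup M (\<lambda>x. ereal \<bar>s x\<bar>) = ereal c"
    if bound: "\<And>k. k < K \<Longrightarrow> \<bar>a k\<bar> \<le> c" and attained: "\<exists>k<K. \<bar>a k\<bar> = c"
  proof (rule antisym)
    obtain m where m: "m < K" "\<bar>a m\<bar> = c" using attained by blast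
    show "esssup M (\<lambda>x. ereal \<bar>s x\<bar>) \<le> ereal c"
      using m by (intro le bound) auto
    show "ereal c \<le> esssup M (\<lambda>x. ereal \<bar>s x\<bar>)"
    proof (rule ccontr)
      assume "\<not> ereal c \<le> esssup M (\<lambda>x. ereal \<bar>s x\<bar>)"
      \<comment> \<open>A smaller essential supremum would make \<open>A m\<close>, where \<open>\<bar>s\<bar> = c\<close>, a null set.\<close>
      then have "AE x in M. x \<notin> A m"
        using esssup_AE[where M = M and f = "\<lambda>x. ereal \<bar>s x\<bar>"] s[OF m(1)] m(2) by (auto elim!: eventually_mono)
      then have "emeasure M (A m) = 0"
        using A[OF m(1)] sets.sets_into_space by (subst (asm) AE_iff_measurable[OF _ refl]) (auto simp: Collect_conj_eq Int_absorb1)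
      then show False using A[OF m(1)] by simp
    qed
  qed
  then show "(\<And>k. k < K \<Longrightarrow> \<bar>a k\<bar> \<le> c) \<Longrightarrow> \<exists>k<K. \<bar>a k\<bar> = c \<Longrightarrow>
      real_of_ereal (esssup M (\<lambda>x. ereal \<bar>s x\<bar>)) = c"
    by simp
qed

section \<open>The constants\<close>

theorem proposition6:
  fixes n :: nat
  assumes "n \<ge> 2"
  shows
    "(\<forall>(p::real) (d::enat). 1 \<le> p \<and> p \<le> 2 \<and> enat n \<le> d \<longrightarrow>
        upper_NJ n (lp_space (ereal p) d) = real n powr (2 / p - 1) \<and>
        upper_mNJ n (lp_space (ereal p) d) = real n powr (2 / p - 1))
   \<and> (\<forall>d::enat. enat (2 ^ (n - 1)) \<le> d \<longrightarrow>
        upper_NJ n (lp_space \<infinity> d) = real n \<and>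
        upper_mNJ n (lp_space \<infinity> d) = real n)
   \<and> (\<forall>d::enat. enat n \<le> d \<longrightarrow>
        lower_NJ n (lp_space \<infinity> d) = 1 / real n \<and>
        lower_mNJ n (lp_space \<infinity> d) = 1 / real n)
   \<and> (\<forall>M::'a measure. sigma_finite_measure M \<and> nonatomic M \<and> emeasure M (space M) > 0 \<longrightarrow>
        upper_mNJ n (L1_space M) = real n \<and>
        upper_NJ n (L1_space M) = real n \<and>
        upper_mNJ n (Linf_space M) = real n \<and>
        upper_NJ n (Linf_space M) = real n \<and>
        lower_mNJ n (Linf_space M) = 1 / real n \<and>
        lower_NJ n (Linf_space M) = 1 / real n)"
proof (intro conjI allI impI; (elim conjE)?)
  have n: "n \<ge> 1" using assms by simp
  {
    fix p :: real and d :: enat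
    assume "1 \<le> p" "p \<le> 2" "enat n \<le> d"
    from lp_upper_constants[OF n this]
    show "upper_NJ n (lp_space (ereal p) d) = real n powr (2 / p - 1)"
      and "upper_mNJ n (lp_space (ereal p) d) = real n powr (2 / p - 1)"
      by simp_all
  next
    fix d :: enat
    interpret linf: seminorm_model "lp_space \<infinity> d" "lp_set \<infinity> d" "lp_norm \<infinity>" id
      by (rule linf_space_model)
    {
      assume d: "enat (2 ^ (n - 1)) \<le> d"
      obtain x where "x \<in> mNJ_tuples n (lp_space \<infinity> d)" "NJ_quot n (lp_space \<infinity> d) x = n"
        using linf.sup_step_upper_witness[OF n linf_step_mem[OF d] linf_step_norm] by blast
      from upper_constants_eqI[OF n this linf.NJ_quot_le[OF n]]
      show "upper_NJ n (lp_space \<infinity> d) = real n" "upper_mNJ n (lp_space \<infinity> d) = real n"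
        by simp_all
    next
      assume d: "enat n \<le> d"
      obtain x where "x \<in> mNJ_tuples n (lp_space \<infinity> d)" "NJ_quot n (lp_space \<infinity> d) x = 1 / n"
        using linf.sup_step_lower_witness[OF n linf_step_mem[OF d] linf_step_norm] by blast
      from lower_constants_eqI[OF n this linf.NJ_quot_ge[OF n]]
      show "lower_NJ n (lp_space \<infinity> d) = 1 / real n" "lower_mNJ n (lp_space \<infinity> d) = 1 / real n"
        by simp_all
    }
  next
    fix M :: "'a measure"
    assume M: "nonatomic M" "emeasure M (space M) > 0"
    have sets: "\<exists>A. disjoint_family_on A {..<K} \<and>
        (\<forall>k<K. A k \<in> sets M \<and> 0 < emeasure M (A k) \<and> emeasure M (A k) < \<infinity>)" for K :: nat
      using nonatomic_disjoint_sets[OF M(1) sets.top M(2), of K] by blast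
    interpret L1: seminorm_model "L1_space M" "{f. integrable M f}" "\<lambda>f. \<integral>x. \<bar>f x\<bar> \<partial>M"
      "\<lambda>f. ae_rel M `` {f}"
      by (rule L1_space_model)
    interpret Linf: seminorm_model "Linf_space M" "Linf_set M"
      "\<lambda>f. real_of_ereal (esssup M (\<lambda>x. ereal \<bar>f x\<bar>))" "\<lambda>f. ae_rel M `` {f}"
      by (rule Linf_space_model[OF M(2)])
    {
      obtain A :: "nat \<Rightarrow> 'a set" where A: "disjoint_family_on A {..<n}"
        "\<forall>k<n. A k \<in> sets M \<and> 0 < emeasure M (A k) \<and> emeasure M (A k) < \<infinity>"
        using sets by blast
      have "\<exists>x\<in>mNJ_tuples n (L1_space M). NJ_quot n (L1_space M) x = n powr (2 / 1 - 1)"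
        using L1_step[OF A(1), of M] A(2) n
        by (intro L1.lp_step_witness[of n 1 "\<lambda>k x. indicator (A k) x / measure M (A k)"])
          (auto simp: sum_nonneg)
      then obtain x where "x \<in> mNJ_tuples n (L1_space M)" "NJ_quot n (L1_space M) x = n"
        using n by auto
      from upper_constants_eqI[OF n this L1.NJ_quot_le[OF n]]
      show "upper_mNJ n (L1_space M) = real n" "upper_NJ n (L1_space M) = real n"
        by simp_all
    next
      obtain A :: "nat \<Rightarrow> 'a set" where A: "disjoint_family_on A {..<2 ^ (n - 1)}"
        "\<forall>k<2 ^ (n - 1). A k \<in> sets M \<and> 0 < emeasure M (A k) \<and> emeasure M (A k) < \<infinity>"
        using sets by blast
      have "\<exists>x\<in>mNJ_tuples n (Linf_space M). NJ_quot n (Linf_space M) x = n"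
        by (intro Linf.sup_step_upper_witness[of n "\<lambda>k. indicator (A k)"] Linf_step n) (use A in auto)
      then obtain x where "x \<in> mNJ_tuples n (Linf_space M)" "NJ_quot n (Linf_space M) x = n"
        by blast
      from upper_constants_eqI[OF n this Linf.NJ_quot_le[OF n]]
      show "upper_mNJ n (Linf_space M) = real n" "upper_NJ n (Linf_space M) = real n"
        by simp_all
    next
      obtain A :: "nat \<Rightarrow> 'a set" where A: "disjoint_family_on A {..<n}"
        "\<forall>k<n. A k \<in> sets M \<and> 0 < emeasure M (A k) \<and> emeasure M (A k) < \<infinity>"
        using sets by blast
      have "\<exists>x\<in>mNJ_tuples n (Linf_space M). NJ_quot n (Linf_space M) x = 1 / n"
        by (intro Linf.sup_step_lower_witness[of n "\<lambda>k. indicator (A k)"] Linf_step n) (use A in auto)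
      then obtain x where "x \<in> mNJ_tuples n (Linf_space M)" "NJ_quot n (Linf_space M) x = 1 / n"
        by blast
      from lower_constants_eqI[OF n this Linf.NJ_quot_ge[OF n]]
      show "lower_mNJ n (Linf_space M) = 1 / real n" "lower_NJ n (Linf_space M) = 1 / real n"
        by simp_all
    }
  }
qed

end
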